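(* Let $\mathcal{M}$ be a unitary magma without nontrivial unit divisors. Then the space $\mathrm{Nes}\mathcal{M}=\mathsf{C}\mathcal{M}/\mathfrak{R}_{\mathrm{Nes}\mathcal{M}}$ is a quotient operad of $\mathsf{C}\mathcal{M}$ (that is, $\mathfrak{R}_{\mathrm{Nes}\mathcal{M}}$ is an operad ideal of $\mathsf{C}\mathcal{M}$).
   Context: Let $\mathbb{K}$ be a field of characteristic zero and $[n]=\{1,\dots,n\}$. A unitary magma is a set $\mathcal{M}$ with a binary operation $\star$ (not assumed associative) having a two-sided unit $\mathbb{1}_{\mathcal{M}}$. It is without nontrivial unit divisors if $a\star b=\mathbb{1}_{\mathcal{M}}$ implies $a=b=\mathbb{1}_{\mathcal{M}}$. Operads are nonsymmetric operads in $\mathbb{K}$-vector spaces (graded from arity $1$, with partial compositions $\circ_i$ and a unit of arity $1$). An operad ideal of $\mathcal{O}$ is a graded subspace $I$ such that $x\circ_i y$ and $y\circ_j x$ are in $I$ for all $x\in\mathcal{O}$, $y\in I$ and valid $i,j$; then $\mathcal{O}/I$ is a quotient operad. An $\mathcal{M}$-clique of arity $n\ge1$ is a map $\mathfrak{p}$ assigning a label $\mathfrak{p}(x,y)\in\mathcal{M}$ to each arc $(x,y)$, $1\le x<y\le n+1$; by convention the only $\mathcal{M}$-clique of arity $1$ is $\mathbf{u}$, with $\mathbf{u}(1,2)=\mathbb{1}_{\mathcal{M}}$. An arc is solid if its label is not $\mathbb{1}_{\mathcal{M}}$. Write $\mathfrak{p}_0:=\mathfrak{p}(1,n+1)$ and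 $\mathfrak{p}_i:=\mathfrak{p}(i,i+1)$ for $i\in[n]$. $\mathsf{C}\mathcal{M}$ is the operad (with unit $\mathbf{u}$) such that $\mathsf{C}\mathcal{M}(n)$ has basis the $\mathcal{M}$-cliques of arity $n$, and for $\mathcal{M}$-cliques $\mathfrak{p},\mathfrak{q}$ of arities $n,m$ and $i\in[n]$, $\mathfrak{p}\circ_i\mathfrak{q}$ is the $\mathcal{M}$-clique of arity $n+m-1$ with, for $1\le x<y\le n+m$, $$(\mathfrak{p}\circ_i\mathfrak{q})(x,y)=\begin{cases}\mathfrak{p}(x,y)&\text{if }y\le i,\\ \mathfrak{p}(x,y-m+1)&\text{if }x\le i<i+m\le y,\ (x,y)\ne(i,i+m),\\ \mathfrak{p}(x-m+1,y-m+1)&\text{if }i+m\le x,\\ \mathfrak{q}(x-i+1,y-i+1)&\text{if }i\le x<y\le i+m,\ (x,y)\ne(i,i+m),\\ \mathfrak{p}_i\star\mathfrak{q}_0&\text{if }(x,y)=(i,i+m),\\ \mathbb{1}_{\mathcal{M}}&\text{otherwise}.\end{cases}$$ An arc $(x',y')$ is nested in an arc $(x,y)$ if $x\le x'<y'\le y$. An $\mathcal{M}$-clique $\mathfrak{p}$ is nesting-free if for all solid arcs $(x,y)$ and $(x',y')$ of $\mathfrak{p}$ such that $(x',y')$ is nested in $(x,y)$, one has $(x,y)=(x',y')$. $\mathfrak{R}_{\mathrm{Nes}\mathcal{M}}$ is the subspace of $\mathsf{C}\mathcal{M}$ spanned by all $\mathcal{M}$-cliques that are not nesting-free. *)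

theory Defs
  imports "HOL.Hull" "HOL-Algebra.Module" "HOL-Algebra.AbelCoset" "HOL-Library.FuncSet"
begin

section \<open>Unitary magmas\<close>

text \<open>The record type of monoids is only used for its fields; associativity is not assumed.\<close>

locale unitary_magma =
  fixes M (structure)
  assumes one_closed: "\<one> \<in> carrier M"
    and mult_closed: "\<lbrakk>a \<in> carrier M; b \<in> carrier M\<rbrakk> \<Longrightarrow> a \<otimes> b \<in> carrier M"
    and l_unit: "a \<in> carrier M \<Longrightarrow> \<one> \<otimes> a = a"
    and r_unit: "a \<in> carrier M \<Longrightarrow> a \<otimes> \<one> = a"

definition no_nontrivial_unit_divisors :: "('m, 'z) monoid_scheme \<Rightarrow> bool" where
  "no_nontrivial_unit_divisors M \<longleftrightarrow>
     (\<forall>a\<in>carrier M. \<forall>b\<in>carrier M. a \<otimes>\<^bsub>M\<^esub> b = \<one>\<^bsub>M\<^esub> \<longrightarrow> a = \<one>\<^bsub>M\<^esub> \<and> b = \<one>\<^bsub>M\<^esub>)"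


section \<open>Nonsymmetric operads, ideals and quotients\<close>

text \<open>
  \<open>pcomp O n m i x y\<close> is the partial composition of \<open>x\<close> of arity \<open>n\<close> with \<open>y\<close> of arity \<open>m\<close>
  at position \<open>i\<close>. The arities are arguments because the carriers of the homogeneous components
  need not be disjoint. Only arities \<open>n \<ge> 1\<close> are meaningful, and the ring product and unit that
  the record of modules inherits from rings play no role.
\<close>

record ('k, 'v) operad =
  component :: "nat \<Rightarrow> ('k, 'v) module"
  pcomp :: "nat \<Rightarrow> nat \<Rightarrow> nat \<Rightarrow> 'v \<Rightarrow> 'v \<Rightarrow> 'v"
  operad_unit :: 'v

locale ns_operad = K?: field K
  for K :: "('k, 'z) ring_scheme" (structure) and P :: "('k, 'v) operad" +
  assumes module_component: "n \<ge> 1 \<Longrightarrow> module K (component P n)"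
    and pcomp_closed:
      "\<lbrakk>x \<in> carrier (component P n); y \<in> carrier (component P m); 1 \<le> i; i \<le> n; 1 \<le> m\<rbrakk>
       \<Longrightarrow> pcomp P n m i x y \<in> carrier (component P (n + m - 1))"
    and pcomp_add_left:
      "\<lbrakk>x \<in> carrier (component P n); x' \<in> carrier (component P n); y \<in> carrier (component P m);
        1 \<le> i; i \<le> n; 1 \<le> m\<rbrakk>
       \<Longrightarrow> pcomp P n m i (x \<oplus>\<^bsub>component P n\<^esub> x') y
           = pcomp P n m i x y \<oplus>\<^bsub>component P (n + m - 1)\<^esub> pcomp P n m i x' y"
    and pcomp_add_right:
      "\<lbrakk>x \<in> carrier (component P n); y \<in> carrier (component P m); y' \<in> carrier (component P m);
        1 \<le> i; i \<le> n; 1 \<le> m\<rbrakk>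
       \<Longrightarrow> pcomp P n m i x (y \<oplus>\<^bsub>component P m\<^esub> y')
           = pcomp P n m i x y \<oplus>\<^bsub>component P (n + m - 1)\<^esub> pcomp P n m i x y'"
    and pcomp_smult_left:
      "\<lbrakk>a \<in> carrier K; x \<in> carrier (component P n); y \<in> carrier (component P m);
        1 \<le> i; i \<le> n; 1 \<le> m\<rbrakk>
       \<Longrightarrow> pcomp P n m i (a \<odot>\<^bsub>component P n\<^esub> x) y
           = a \<odot>\<^bsub>component P (n + m - 1)\<^esub> pcomp P n m i x y"
    and pcomp_smult_right:
      "\<lbrakk>a \<in> carrier K; x \<in> carrier (component P n); y \<in> carrier (component P m);
        1 \<le> i; i \<le> n; 1 \<le> m\<rbrakk>
       \<Longrightarrow> pcomp P n m i x (a \<odot>\<^bsub>component P m\<^esub> y)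
           = a \<odot>\<^bsub>component P (n + m - 1)\<^esub> pcomp P n m i x y"
    and pcomp_sequential:
      "\<lbrakk>x \<in> carrier (component P n); y \<in> carrier (component P m); z \<in> carrier (component P l);
        1 \<le> i; i \<le> n; 1 \<le> j; j \<le> m; 1 \<le> l\<rbrakk>
       \<Longrightarrow> pcomp P (n + m - 1) l (i + j - 1) (pcomp P n m i x y) z
           = pcomp P n (m + l - 1) i x (pcomp P m l j y z)"
    and pcomp_parallel:
      "\<lbrakk>x \<in> carrier (component P n); y \<in> carrier (component P m); z \<in> carrier (component P l);
        1 \<le> i; i < j; j \<le> n; 1 \<le> m; 1 \<le> l\<rbrakk>
       \<Longrightarrow> pcomp P (n + m - 1) l (j + m - 1) (pcomp P n m i x y) z
           = pcomp P (n + l - 1) m i (pcomp P n l j x z) y"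
    and unit_closed: "operad_unit P \<in> carrier (component P 1)"
    and unit_left:
      "\<lbrakk>x \<in> carrier (component P n); 1 \<le> n\<rbrakk> \<Longrightarrow> pcomp P 1 n 1 (operad_unit P) x = x"
    and unit_right:
      "\<lbrakk>x \<in> carrier (component P n); 1 \<le> i; i \<le> n\<rbrakk> \<Longrightarrow> pcomp P n 1 i x (operad_unit P) = x"

locale operad_ideal = ns_operad K P
  for K :: "('k, 'z) ring_scheme" (structure) and P :: "('k, 'v) operad"
    and I :: "nat \<Rightarrow> 'v set" +
  assumes graded_subspace: "n \<ge> 1 \<Longrightarrow> submodule (I n) K (component P n)"
    and pcomp_ideal_right:
      "\<lbrakk>x \<in> carrier (component P n); y \<in> I m; 1 \<le> i; i \<le> n; 1 \<le> m\<rbrakk>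
       \<Longrightarrow> pcomp P n m i x y \<in> I (n + m - 1)"
    and pcomp_ideal_left:
      "\<lbrakk>y \<in> I m; x \<in> carrier (component P n); 1 \<le> j; j \<le> m; 1 \<le> n\<rbrakk>
       \<Longrightarrow> pcomp P m n j y x \<in> I (m + n - 1)"

definition quotient_module :: "('k, 'v) module \<Rightarrow> 'v set \<Rightarrow> ('k, 'v set) module" where
  "quotient_module V H =
     \<lparr>carrier = a_rcosets\<^bsub>V\<^esub> H, mult = (\<lambda>_ _. undefined), one = undefined,
      zero = H, add = set_add V, smult = (\<lambda>a X. \<Union>x\<in>X. H +>\<^bsub>V\<^esub> (a \<odot>\<^bsub>V\<^esub> x))\<rparr>"

definition quotient_operad ::
    "('k, 'v) operad \<Rightarrow> (nat \<Rightarrow> 'v set) \<Rightarrow> ('k, 'v set) operad" where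
  "quotient_operad P I =
     \<lparr>component = (\<lambda>n. quotient_module (component P n) (I n)),
      pcomp = (\<lambda>n m i X Y. \<Union>x\<in>X. \<Union>y\<in>Y.
        I (n + m - 1) +>\<^bsub>component P (n + m - 1)\<^esub> pcomp P n m i x y),
      operad_unit = I 1 +>\<^bsub>component P 1\<^esub> operad_unit P\<rparr>"


section \<open>The operad of cliques\<close>

definition arcs :: "nat \<Rightarrow> (nat \<times> nat) set" where
  "arcs n = {(x, y). 1 \<le> x \<and> x < y \<and> y \<le> n + 1}"

definition cliques :: "('m, 'z) monoid_scheme \<Rightarrow> nat \<Rightarrow> (nat \<times> nat \<Rightarrow> 'm) set" where
  "cliques M n = {p \<in> arcs n \<rightarrow>\<^sub>E carrier M. n = 1 \<longrightarrow> p (1, 2) = \<one>\<^bsub>M\<^esub>}"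

definition unit_clique :: "('m, 'z) monoid_scheme \<Rightarrow> nat \<times> nat \<Rightarrow> 'm" where
  "unit_clique M = (\<lambda>a\<in>arcs 1. \<one>\<^bsub>M\<^esub>)"

definition clique_comp ::
    "('m, 'z) monoid_scheme \<Rightarrow> nat \<Rightarrow> nat \<Rightarrow> nat
     \<Rightarrow> (nat \<times> nat \<Rightarrow> 'm) \<Rightarrow> (nat \<times> nat \<Rightarrow> 'm) \<Rightarrow> (nat \<times> nat \<Rightarrow> 'm)" where
  "clique_comp M n m i p q = (\<lambda>(x, y)\<in>arcs (n + m - 1).
     if y \<le> i then p (x, y)
     else if x \<le> i \<and> i + m \<le> y \<and> (x, y) \<noteq> (i, i + m) then p (x, y - m + 1)
     else if i + m \<le> x then p (x - m + 1, y - m + 1)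
     else if i \<le> x \<and> y \<le> i + m \<and> (x, y) \<noteq> (i, i + m) then q (x - i + 1, y - i + 1)
     else if (x, y) = (i, i + m) then p (i, i + 1) \<otimes>\<^bsub>M\<^esub> q (1, m + 1)
     else \<one>\<^bsub>M\<^esub>)"

text \<open>
  The vector space with basis \<open>B\<close>, as the finitely supported functions on \<open>B\<close>
  (extended by zero outside of \<open>B\<close>).
\<close>

definition free_module :: "('k, 'z) ring_scheme \<Rightarrow> 'b set \<Rightarrow> ('k, 'b \<Rightarrow> 'k) module" where
  "free_module K B =
     \<lparr>carrier = {f. (\<forall>b. f b \<in> carrier K) \<and> {b. f b \<noteq> \<zero>\<^bsub>K\<^esub>} \<subseteq> B \<and> finite {b. f b \<noteq> \<zero>\<^bsub>K\<^esub>}},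
      mult = (\<lambda>_ _. undefined), one = undefined,
      zero = (\<lambda>_. \<zero>\<^bsub>K\<^esub>), add = (\<lambda>f g b. f b \<oplus>\<^bsub>K\<^esub> g b), smult = (\<lambda>a f b. a \<otimes>\<^bsub>K\<^esub> f b)\<rparr>"

definition basis_vector :: "('k, 'z) ring_scheme \<Rightarrow> 'b \<Rightarrow> 'b \<Rightarrow> 'k" where
  "basis_vector K b = (\<lambda>c. if c = b then \<one>\<^bsub>K\<^esub> else \<zero>\<^bsub>K\<^esub>)"

text \<open>
  The partial compositions extend \<^const>\<open>clique_comp\<close> bilinearly: the coefficient of a clique
  \<open>r\<close> is the sum of \<open>f p \<otimes> g q\<close> over the \<open>(p, q)\<close> in the supports whose composition is \<open>r\<close>.
\<close>

definition clique_operad ::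
    "('k, 'z) ring_scheme \<Rightarrow> ('m, 'y) monoid_scheme \<Rightarrow> ('k, (nat \<times> nat \<Rightarrow> 'm) \<Rightarrow> 'k) operad" where
  "clique_operad K M =
     \<lparr>component = (\<lambda>n. free_module K (cliques M n)),
      pcomp = (\<lambda>n m i f g r.
        finsum K (\<lambda>(p, q). f p \<otimes>\<^bsub>K\<^esub> g q)
          {(p, q). f p \<noteq> \<zero>\<^bsub>K\<^esub> \<and> g q \<noteq> \<zero>\<^bsub>K\<^esub> \<and> clique_comp M n m i p q = r}),
      operad_unit = basis_vector K (unit_clique M)\<rparr>"


section \<open>Nesting-free cliques\<close>

definition solid_arcs :: "('m, 'z) monoid_scheme \<Rightarrow> nat \<Rightarrow> (nat \<times> nat \<Rightarrow> 'm) \<Rightarrow> (nat \<times> nat) set"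
  where "solid_arcs M n p = {a \<in> arcs n. p a \<noteq> \<one>\<^bsub>M\<^esub>}"

definition nested :: "nat \<times> nat \<Rightarrow> nat \<times> nat \<Rightarrow> bool" where
  "nested = (\<lambda>(x', y') (x, y). x \<le> x' \<and> x' < y' \<and> y' \<le> y)"

definition nesting_free :: "('m, 'z) monoid_scheme \<Rightarrow> nat \<Rightarrow> (nat \<times> nat \<Rightarrow> 'm) \<Rightarrow> bool" where
  "nesting_free M n p \<longleftrightarrow>
     (\<forall>a\<in>solid_arcs M n p. \<forall>a'\<in>solid_arcs M n p. nested a' a \<longrightarrow> a = a')"

definition nes_relations ::
    "('k, 'z) ring_scheme \<Rightarrow> ('m, 'y) monoid_scheme \<Rightarrow> nat \<Rightarrow> ((nat \<times> nat \<Rightarrow> 'm) \<Rightarrow> 'k) set" where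
  "nes_relations K M n =
     (\<lambda>H. submodule H K (component (clique_operad K M) n)) hull
       (basis_vector K ` {p \<in> cliques M n. \<not> nesting_free M n p})"

definition nes_operad ::
    "('k, 'z) ring_scheme \<Rightarrow> ('m, 'y) monoid_scheme
     \<Rightarrow> ('k, ((nat \<times> nat \<Rightarrow> 'm) \<Rightarrow> 'k) set) operad" where
  "nes_operad K M = quotient_operad (clique_operad K M) (nes_relations K M)"

end

theory Submission
  imports Defs
begin

text \<open>
  The ideal property comes down to basis elements. A composition \<open>p \<circ>\<^sub>i q\<close> contains a copy of
  every arc of \<open>p\<close> and of every arc of \<open>q\<close>: the arcs of \<open>q\<close> are translated by \<open>i - 1\<close>, and those
  of \<open>p\<close> are stretched by the increasing map that skips the inner vertices of \<open>q\<close>. Both maps are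
  injective on arcs and preserve nesting. Labels are preserved as well, except that the arc
  \<open>(i, i + 1)\<close> of \<open>p\<close> and the arc \<open>(1, m + 1)\<close> of \<open>q\<close> are glued to one arc whose label is the
  product of theirs. Without nontrivial unit divisors this product is different from the unit as
  soon as one of the factors is, so solid arcs go to solid arcs. Hence a pair of nested solid arcs in
  \<open>p\<close> or in \<open>q\<close> yields such a pair in \<open>p \<circ>\<^sub>i q\<close> (\<open>not_nesting_free_clique_comp_left\<close>,
  \<open>not_nesting_free_clique_comp_right\<close>). Since preimages of submodules under linear maps are
  submodules, this passes from basis elements to their spans (\<open>operad_ideal_nes_relations\<close>).

  An operad ideal lives in an operad, so the operad axioms for cliques are needed too. All of
  them are identities between multilinear maps, which need only be checked on basis elements
  (\<open>linear_map_eqI\<close>, \<open>trilinear_eqI\<close>). There they are identities of cliques, verified arc by arc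
  according to the position of the two endpoints (\<open>clique_comp_parallel\<close>,
  \<open>clique_comp_sequential\<close>). The magma is not associative: the only instance of associativity
  that occurs has a clique of arity \<open>1\<close> in the middle, whose label is the unit by convention.

  Finally, the quotient of any operad by an operad ideal is an operad, since the operations on cosets
  are given by representatives (\<open>ns_operad_quotient_operad\<close>).
\<close>


section \<open>Linear maps and generated submodules\<close>

text \<open>
  The map \<open>F\<close> is linear from \<open>V\<close> to \<open>W\<close>; only its values on the carrier of \<open>V\<close> matter.
\<close>

definition linear_map ::
    "('k, 'z) ring_scheme \<Rightarrow> ('k, 'v) module \<Rightarrow> ('k, 'w) module \<Rightarrow> ('v \<Rightarrow> 'w) \<Rightarrow> bool" where
  "linear_map K V W F \<longleftrightarrow>
     (\<forall>x\<in>carrier V. F x \<in> carrier W)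
     \<and> (\<forall>x\<in>carrier V. \<forall>y\<in>carrier V. F (x \<oplus>\<^bsub>V\<^esub> y) = F x \<oplus>\<^bsub>W\<^esub> F y)
     \<and> (\<forall>a\<in>carrier K. \<forall>x\<in>carrier V. F (a \<odot>\<^bsub>V\<^esub> x) = a \<odot>\<^bsub>W\<^esub> F x)"

lemma linear_mapI:
  assumes "\<And>x. x \<in> carrier V \<Longrightarrow> F x \<in> carrier W"
    and "\<And>x y. \<lbrakk>x \<in> carrier V; y \<in> carrier V\<rbrakk> \<Longrightarrow> F (x \<oplus>\<^bsub>V\<^esub> y) = F x \<oplus>\<^bsub>W\<^esub> F y"
    and "\<And>a x. \<lbrakk>a \<in> carrier K; x \<in> carrier V\<rbrakk> \<Longrightarrow> F (a \<odot>\<^bsub>V\<^esub> x) = a \<odot>\<^bsub>W\<^esub> F x"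
  shows "linear_map K V W F"
  using assms unfolding linear_map_def by blast

lemma linear_map_closed: "\<lbrakk>linear_map K V W F; x \<in> carrier V\<rbrakk> \<Longrightarrow> F x \<in> carrier W"
  and linear_map_add: "\<lbrakk>linear_map K V W F; x \<in> carrier V; y \<in> carrier V\<rbrakk>
    \<Longrightarrow> F (x \<oplus>\<^bsub>V\<^esub> y) = F x \<oplus>\<^bsub>W\<^esub> F y"
  and linear_map_smult: "\<lbrakk>linear_map K V W F; a \<in> carrier K; x \<in> carrier V\<rbrakk>
    \<Longrightarrow> F (a \<odot>\<^bsub>V\<^esub> x) = a \<odot>\<^bsub>W\<^esub> F x"
  unfolding linear_map_def by blast+

lemma linear_map_compose:
  assumes "linear_map K V W F" "linear_map K W X G"
  shows "linear_map K V X (\<lambda>x. G (F x))"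
  using assms by (simp add: linear_map_def)

lemma linear_map_id: "linear_map K V V (\<lambda>x. x)"
  by (simp add: linear_map_def)

text \<open>Closure under negation is automatic, as \<open>\<ominus> x = (\<ominus> \<one>) \<odot> x\<close>.\<close>

lemma (in module) submoduleI_add_smult:
  assumes subset: "H \<subseteq> carrier M"
    and zero: "\<zero>\<^bsub>M\<^esub> \<in> H"
    and add: "\<And>a b. \<lbrakk>a \<in> H; b \<in> H\<rbrakk> \<Longrightarrow> a \<oplus>\<^bsub>M\<^esub> b \<in> H"
    and smult: "\<And>a x. \<lbrakk>a \<in> carrier R; x \<in> H\<rbrakk> \<Longrightarrow> a \<odot>\<^bsub>M\<^esub> x \<in> H"
  shows "submodule H R M"
proof (rule submoduleI)
  fix x assume x: "x \<in> H"
  then have "\<ominus>\<^bsub>M\<^esub> x = (\<ominus> \<one>) \<odot>\<^bsub>M\<^esub> x"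
    using subset by (auto simp: smult_l_minus)
  with x smult show "\<ominus>\<^bsub>M\<^esub> x \<in> H" by simp
qed (use assms in auto)

lemma linear_map_zero:
  assumes "module K V" "module K W" "linear_map K V W F"
  shows "F \<zero>\<^bsub>V\<^esub> = \<zero>\<^bsub>W\<^esub>"
proof -
  interpret V: module K V by fact
  interpret W: module K W by fact
  have "F (\<zero>\<^bsub>K\<^esub> \<odot>\<^bsub>V\<^esub> \<zero>\<^bsub>V\<^esub>) = \<zero>\<^bsub>K\<^esub> \<odot>\<^bsub>W\<^esub> F \<zero>\<^bsub>V\<^esub>"
    by (rule linear_map_smult[OF assms(3)]) auto
  moreover have "F \<zero>\<^bsub>V\<^esub> \<in> carrier W"
    by (rule linear_map_closed[OF assms(3)]) auto
  ultimately show ?thesis by simp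
qed

lemma submodule_vimage:
  assumes "module K V" "module K W" "linear_map K V W F" "submodule H K W"
  shows "submodule {x \<in> carrier V. F x \<in> H} K V"
proof -
  interpret V: module K V by fact
  interpret W: module K W by fact
  interpret H: submodule H K W by fact
  show ?thesis
    using H.one_closed H.m_closed
    by (intro V.submoduleI_add_smult)
      (auto simp: linear_map_zero[OF assms(1-3)] linear_map_add[OF assms(3)]
        linear_map_smult[OF assms(3)])
qed

lemma submodule_equalizer:
  assumes "module K V" "module K W" "linear_map K V W F" "linear_map K V W G"
  shows "submodule {x \<in> carrier V. F x = G x} K V"
proof -
  interpret V: module K V by fact
  show ?thesis
    by (intro V.submoduleI_add_smult)
      (auto simp: linear_map_zero[OF assms(1-3)] linear_map_zero[OF assms(1,2,4)]
        linear_map_add[OF assms(3)] linear_map_add[OF assms(4)]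
        linear_map_smult[OF assms(3)] linear_map_smult[OF assms(4)])
qed

lemma (in module) submodule_hull:
  assumes "S \<subseteq> carrier M"
  shows "submodule ((\<lambda>H. submodule H R M) hull S) R M"
proof -
  let ?X = "(\<lambda>H. submodule H R M) hull S"
  have sub: "?X \<subseteq> carrier M"
    by (intro hull_minimal assms carrier_is_submodule)
  have zero: "\<zero>\<^bsub>M\<^esub> \<in> H" if "submodule H R M" for H
    using subgroup.one_closed[OF submodule.axioms(1)[OF that]] by simp
  show ?thesis
    using sub zero
    by (intro submoduleI_add_smult) (auto simp: hull_def intro: submoduleE(4,5))
qed


section \<open>Free modules\<close>

lemma (in cring) module_free_module: "module R (free_module R B)"
proof -
  let ?V = "free_module R B"
  have add: "f \<oplus>\<^bsub>?V\<^esub> g \<in> carrier ?V" if "f \<in> carrier ?V" "g \<in> carrier ?V" for f g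
  proof -
    have "{b. f b \<oplus> g b \<noteq> \<zero>} \<subseteq> {b. f b \<noteq> \<zero>} \<union> {b. g b \<noteq> \<zero>}" by auto
    with that show ?thesis
      unfolding free_module_def by (auto intro: finite_subset)
  qed
  have smult: "a \<odot>\<^bsub>?V\<^esub> f \<in> carrier ?V" if "a \<in> carrier R" "f \<in> carrier ?V" for a f
  proof -
    have "{b. a \<otimes> f b \<noteq> \<zero>} \<subseteq> {b. f b \<noteq> \<zero>}" using that by auto
    with that show ?thesis
      unfolding free_module_def by (auto intro: finite_subset)
  qed
  have "abelian_group ?V"
  proof (rule abelian_groupI)
    fix f assume f: "f \<in> carrier ?V"
    then have "\<ominus> \<one> \<odot>\<^bsub>?V\<^esub> f \<in> carrier ?V" by (intro smult) auto
    moreover from f have "(\<ominus> \<one> \<odot>\<^bsub>?V\<^esub> f) \<oplus>\<^bsub>?V\<^esub> f = \<zero>\<^bsub>?V\<^esub>"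
      by (auto simp: free_module_def fun_eq_iff l_minus l_neg)
    ultimately show "\<exists>g\<in>carrier ?V. g \<oplus>\<^bsub>?V\<^esub> f = \<zero>\<^bsub>?V\<^esub>" by blast
  qed (use add in \<open>auto simp: free_module_def fun_eq_iff a_ac\<close>)
  then show ?thesis
  proof (rule moduleI[OF is_cring])
    fix a f assume "a \<in> carrier R" "f \<in> carrier ?V"
    then show "a \<odot>\<^bsub>?V\<^esub> f \<in> carrier ?V" by (rule smult)
  qed (auto simp: free_module_def fun_eq_iff l_distr r_distr m_assoc)
qed

lemma (in field) basis_vector_closed:
  "b \<in> B \<Longrightarrow> basis_vector R b \<in> carrier (free_module R B)"
  by (auto simp: basis_vector_def free_module_def)

lemma (in field) free_module_eq_span:
  assumes H: "submodule H R (free_module R B)" and B: "basis_vector R ` B \<subseteq> H"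
  shows "H = carrier (free_module R B)"
proof
  let ?V = "free_module R B"
  interpret V: module R ?V by (rule module_free_module)
  show "H \<subseteq> carrier ?V" by (rule V.submoduleE(1)[OF H])
  \<comment> \<open>Induction on a finite set containing the support: remove one basis vector at a time.\<close>
  have *: "f \<in> H" if "finite S" "f \<in> carrier ?V" "{b. f b \<noteq> \<zero>} \<subseteq> S" for f S
    using that
  proof (induction S arbitrary: f)
    case empty
    then have "f = \<zero>\<^bsub>?V\<^esub>" by (auto simp: free_module_def)
    then show ?case using subgroup.one_closed[OF submodule.axioms(1)[OF H]] by simp
  next
    case (insert c S)
    show ?case
    proof (cases "f c = \<zero>")
      case True
      with insert.prems have "{b. f b \<noteq> \<zero>} \<subseteq> S" by auto
      with insert show ?thesis by blast
    next
      case False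
      let ?g = "f(c := \<zero>)"
      from False insert.prems have c: "c \<in> B" "f c \<in> carrier R" by (auto simp: free_module_def)
      have "{b. ?g b \<noteq> \<zero>} \<subseteq> {b. f b \<noteq> \<zero>}" by auto
      then have "?g \<in> carrier ?V"
        using insert.prems by (auto simp: free_module_def intro: finite_subset)
      moreover have "{b. ?g b \<noteq> \<zero>} \<subseteq> S" using insert.prems by auto
      ultimately have "?g \<in> H" by (rule insert.IH)
      moreover have "f c \<odot>\<^bsub>?V\<^esub> basis_vector R c \<in> H"
        using B c by (intro V.submoduleE(4)[OF H]) auto
      ultimately have "?g \<oplus>\<^bsub>?V\<^esub> (f c \<odot>\<^bsub>?V\<^esub> basis_vector R c) \<in> H"
        by (rule V.submoduleE(5)[OF H])
      moreover have "?g \<oplus>\<^bsub>?V\<^esub> (f c \<odot>\<^bsub>?V\<^esub> basis_vector R c) = f"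
        using insert.prems(1) by (auto simp: free_module_def basis_vector_def fun_eq_iff)
      ultimately show ?thesis by simp
    qed
  qed
  show "carrier ?V \<subseteq> H"
  proof
    fix f assume f: "f \<in> carrier ?V"
    then have "finite {b. f b \<noteq> \<zero>}" by (simp add: free_module_def)
    then show "f \<in> H" by (rule *[OF _ f]) simp
  qed
qed

lemma (in field) linear_map_eqI:
  assumes "module R W" "linear_map R (free_module R B) W F" "linear_map R (free_module R B) W G"
    and "\<And>b. b \<in> B \<Longrightarrow> F (basis_vector R b) = G (basis_vector R b)"
    and "x \<in> carrier (free_module R B)"
  shows "F x = G x"
proof -
  let ?E = "{x \<in> carrier (free_module R B). F x = G x}"
  have "submodule ?E R (free_module R B)"
    by (rule submodule_equalizer[OF module_free_module assms(1-3)])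
  moreover have "basis_vector R ` B \<subseteq> ?E"
    using assms(4) basis_vector_closed by auto
  ultimately have "?E = carrier (free_module R B)" by (rule free_module_eq_span)
  with assms(5) show ?thesis by blast
qed

lemma (in field) trilinear_eqI:
  assumes W: "module R W"
    and Fx: "\<And>y z. \<lbrakk>y \<in> carrier (free_module R B'); z \<in> carrier (free_module R B'')\<rbrakk>
      \<Longrightarrow> linear_map R (free_module R B) W (\<lambda>x. F x y z)"
    and Gx: "\<And>y z. \<lbrakk>y \<in> carrier (free_module R B'); z \<in> carrier (free_module R B'')\<rbrakk>
      \<Longrightarrow> linear_map R (free_module R B) W (\<lambda>x. G x y z)"
    and Fy: "\<And>x z. \<lbrakk>x \<in> carrier (free_module R B); z \<in> carrier (free_module R B'')\<rbrakk>
      \<Longrightarrow> linear_map R (free_module R B') W (\<lambda>y. F x y z)"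
    and Gy: "\<And>x z. \<lbrakk>x \<in> carrier (free_module R B); z \<in> carrier (free_module R B'')\<rbrakk>
      \<Longrightarrow> linear_map R (free_module R B') W (\<lambda>y. G x y z)"
    and Fz: "\<And>x y. \<lbrakk>x \<in> carrier (free_module R B); y \<in> carrier (free_module R B')\<rbrakk>
      \<Longrightarrow> linear_map R (free_module R B'') W (F x y)"
    and Gz: "\<And>x y. \<lbrakk>x \<in> carrier (free_module R B); y \<in> carrier (free_module R B')\<rbrakk>
      \<Longrightarrow> linear_map R (free_module R B'') W (G x y)"
    and basis: "\<And>p q r. \<lbrakk>p \<in> B; q \<in> B'; r \<in> B''\<rbrakk>
      \<Longrightarrow> F (basis_vector R p) (basis_vector R q) (basis_vector R r)
        = G (basis_vector R p) (basis_vector R q) (basis_vector R r)"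
    and x: "x \<in> carrier (free_module R B)"
    and y: "y \<in> carrier (free_module R B')"
    and z: "z \<in> carrier (free_module R B'')"
  shows "F x y z = G x y z"
proof -
  have 1: "F (basis_vector R p) (basis_vector R q) z = G (basis_vector R p) (basis_vector R q) z"
    if "p \<in> B" "q \<in> B'" for p q
    using that
    by (intro linear_map_eqI[OF W Fz Gz basis z] basis_vector_closed)
  have 2: "F (basis_vector R p) y z = G (basis_vector R p) y z" if "p \<in> B" for p
    using that
    by (intro linear_map_eqI[OF W Fy Gy 1 y] basis_vector_closed z)
  show ?thesis
    by (rule linear_map_eqI[OF W Fx[OF y z] Gx[OF y z] 2 x])
qed


subsection \<open>Bilinear extensions\<close>

text \<open>
  The bilinear extension to free modules of an operation \<open>c\<close> on basis elements, given by its
  coefficient at \<open>r\<close>. The index set involves only the supports of \<open>f\<close> and \<open>g\<close>, hence is finite.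
\<close>

definition bilinear_extension ::
    "('k, 'z) ring_scheme \<Rightarrow> ('a \<Rightarrow> 'b \<Rightarrow> 'c) \<Rightarrow> ('a \<Rightarrow> 'k) \<Rightarrow> ('b \<Rightarrow> 'k) \<Rightarrow> 'c \<Rightarrow> 'k" where
  "bilinear_extension K c f g r =
     finsum K (\<lambda>(p, q). f p \<otimes>\<^bsub>K\<^esub> g q)
       {(p, q). f p \<noteq> \<zero>\<^bsub>K\<^esub> \<and> g q \<noteq> \<zero>\<^bsub>K\<^esub> \<and> c p q = r}"

context field
begin

text \<open>
  Any finite sets containing the supports may be used for the summation. This gives sums that
  are to be added a common index set.
\<close>

lemma bilinear_extension_superset:
  assumes "finite S" "finite T" "{p. f p \<noteq> \<zero>} \<subseteq> S" "{q. g q \<noteq> \<zero>} \<subseteq> T"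
    and "\<And>p. f p \<in> carrier R" "\<And>q. g q \<in> carrier R"
  shows "bilinear_extension R c f g r
    = finsum R (\<lambda>(p, q). f p \<otimes> g q) {(p, q). p \<in> S \<and> q \<in> T \<and> c p q = r}"
  unfolding bilinear_extension_def
proof (rule add.finprod_mono_neutral_cong_left)
  show "finite {(p, q). p \<in> S \<and> q \<in> T \<and> c p q = r}"
    by (rule finite_subset[of _ "S \<times> T"]) (use assms in auto)
  fix i assume "i \<in> {(p, q). p \<in> S \<and> q \<in> T \<and> c p q = r}
      - {(p, q). f p \<noteq> \<zero> \<and> g q \<noteq> \<zero> \<and> c p q = r}"
  then show "(case i of (p, q) \<Rightarrow> f p \<otimes> g q) = \<zero>" using assms(5,6) by auto
qed (use assms in auto)

lemma bilinear_extension_closed: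
  assumes c: "\<And>p q. \<lbrakk>p \<in> B; q \<in> B'\<rbrakk> \<Longrightarrow> c p q \<in> B''"
    and f: "f \<in> carrier (free_module R B)" and g: "g \<in> carrier (free_module R B')"
  shows "bilinear_extension R c f g \<in> carrier (free_module R B'')"
proof -
  let ?S = "(\<lambda>(p, q). c p q) ` ({p. f p \<noteq> \<zero>} \<times> {q. g q \<noteq> \<zero>})"
  have carr: "f p \<in> carrier R" "g q \<in> carrier R" for p q
    using f g by (auto simp: free_module_def)
  have "bilinear_extension R c f g r = \<zero>" if "r \<notin> ?S" for r
  proof -
    from that have "{(p, q). f p \<noteq> \<zero> \<and> g q \<noteq> \<zero> \<and> c p q = r} = {}" by force
    then show ?thesis unfolding bilinear_extension_def by (simp only: finsum_empty)
  qed
  then have supp: "{r. bilinear_extension R c f g r \<noteq> \<zero>} \<subseteq> ?S" by blast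
  have "finite ?S" using f g by (auto simp: free_module_def)
  moreover have "?S \<subseteq> B''" using f g by (auto simp: free_module_def intro!: c)
  moreover have "bilinear_extension R c f g r \<in> carrier R" for r
    unfolding bilinear_extension_def by (rule finsum_closed) (auto intro: carr)
  ultimately show ?thesis
    using supp by (auto simp: free_module_def intro: finite_subset)
qed

lemma linear_map_bilinear_extension_left:
  assumes c: "\<And>p q. \<lbrakk>p \<in> B; q \<in> B'\<rbrakk> \<Longrightarrow> c p q \<in> B''"
    and g: "g \<in> carrier (free_module R B')"
  shows "linear_map R (free_module R B) (free_module R B'') (\<lambda>f. bilinear_extension R c f g)"
proof (rule linear_mapI)
  fix f assume f: "f \<in> carrier (free_module R B)"
  show "bilinear_extension R c f g \<in> carrier (free_module R B'')"
    by (rule bilinear_extension_closed) (use c f g in auto)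
next
  fix f h assume fh: "f \<in> carrier (free_module R B)" "h \<in> carrier (free_module R B)"
  let ?S = "{p. f p \<noteq> \<zero>} \<union> {p. h p \<noteq> \<zero>}" and ?T = "{q. g q \<noteq> \<zero>}"
  note ext = bilinear_extension_superset[of ?S ?T]
  have carr: "f p \<in> carrier R" "h p \<in> carrier R" "g q \<in> carrier R" for p q
    using fh g by (auto simp: free_module_def)
  have fin: "finite ?S" "finite ?T" using fh g by (auto simp: free_module_def)
  have "bilinear_extension R c (\<lambda>b. f b \<oplus> h b) g r
    = bilinear_extension R c f g r \<oplus> bilinear_extension R c h g r" for r
  proof -
    have "bilinear_extension R c (\<lambda>b. f b \<oplus> h b) g r
      = finsum R (\<lambda>(p, q). (f p \<oplus> h p) \<otimes> g q) {(p, q). p \<in> ?S \<and> q \<in> ?T \<and> c p q = r}"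
      by (rule ext) (use carr fin in auto)
    also have "\<dots> = finsum R (\<lambda>x. (case x of (p, q) \<Rightarrow> f p \<otimes> g q) \<oplus> (case x of (p, q) \<Rightarrow> h p \<otimes> g q))
        {(p, q). p \<in> ?S \<and> q \<in> ?T \<and> c p q = r}"
      by (rule finsum_cong') (use carr in \<open>auto simp: l_distr\<close>)
    also have "\<dots> = finsum R (\<lambda>(p, q). f p \<otimes> g q) {(p, q). p \<in> ?S \<and> q \<in> ?T \<and> c p q = r}
        \<oplus> finsum R (\<lambda>(p, q). h p \<otimes> g q) {(p, q). p \<in> ?S \<and> q \<in> ?T \<and> c p q = r}"
      by (rule finsum_addf) (use carr in auto)
    also have "\<dots> = bilinear_extension R c f g r \<oplus> bilinear_extension R c h g r"
      by (subst (1 2) ext) (use carr fin in auto)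
    finally show ?thesis .
  qed
  then show "bilinear_extension R c (f \<oplus>\<^bsub>free_module R B\<^esub> h) g
      = bilinear_extension R c f g \<oplus>\<^bsub>free_module R B''\<^esub> bilinear_extension R c h g"
    by (simp add: free_module_def fun_eq_iff)
next
  fix a f assume a: "a \<in> carrier R" and f: "f \<in> carrier (free_module R B)"
  let ?S = "{p. f p \<noteq> \<zero>}" and ?T = "{q. g q \<noteq> \<zero>}"
  note ext = bilinear_extension_superset[of ?S ?T]
  have carr: "f p \<in> carrier R" "g q \<in> carrier R" for p q
    using f g by (auto simp: free_module_def)
  have fin: "finite ?S" "finite ?T" using f g by (auto simp: free_module_def)
  have "bilinear_extension R c (\<lambda>b. a \<otimes> f b) g r = a \<otimes> bilinear_extension R c f g r" for r
  proof -
    have "bilinear_extension R c (\<lambda>b. a \<otimes> f b) g r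
      = finsum R (\<lambda>(p, q). (a \<otimes> f p) \<otimes> g q) {(p, q). p \<in> ?S \<and> q \<in> ?T \<and> c p q = r}"
      by (rule ext) (use carr fin a in auto)
    also have "\<dots> = finsum R (\<lambda>x. a \<otimes> (case x of (p, q) \<Rightarrow> f p \<otimes> g q))
        {(p, q). p \<in> ?S \<and> q \<in> ?T \<and> c p q = r}"
      by (rule finsum_cong') (use carr a in \<open>auto simp: m_assoc\<close>)
    also have "\<dots> = a \<otimes> finsum R (\<lambda>(p, q). f p \<otimes> g q) {(p, q). p \<in> ?S \<and> q \<in> ?T \<and> c p q = r}"
      by (rule finsum_rdistr[symmetric])
        (use carr a fin in \<open>auto intro: finite_subset[of _ "?S \<times> ?T"]\<close>)
    also have "\<dots> = a \<otimes> bilinear_extension R c f g r"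
      by (subst ext) (use carr fin in auto)
    finally show ?thesis .
  qed
  then show "bilinear_extension R c (a \<odot>\<^bsub>free_module R B\<^esub> f) g
      = a \<odot>\<^bsub>free_module R B''\<^esub> bilinear_extension R c f g"
    by (simp add: free_module_def fun_eq_iff)
qed

lemma bilinear_extension_swap:
  assumes "\<And>p. f p \<in> carrier R" "\<And>q. g q \<in> carrier R"
  shows "bilinear_extension R c f g = bilinear_extension R (\<lambda>q p. c p q) g f"
proof
  fix r
  let ?A = "{(q, p). g q \<noteq> \<zero> \<and> f p \<noteq> \<zero> \<and> c p q = r}"
  have "{(p, q). f p \<noteq> \<zero> \<and> g q \<noteq> \<zero> \<and> c p q = r} = prod.swap ` ?A" by force
  then have "bilinear_extension R c f g r = finsum R (\<lambda>(p, q). f p \<otimes> g q) (prod.swap ` ?A)"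
    by (simp add: bilinear_extension_def)
  also have "\<dots> = finsum R (\<lambda>x. (\<lambda>(p, q). f p \<otimes> g q) (prod.swap x)) ?A"
    by (rule finsum_reindex) (use assms in auto)
  also have "\<dots> = finsum R (\<lambda>(q, p). g q \<otimes> f p) ?A"
    by (rule finsum_cong') (use assms in \<open>auto simp: m_comm\<close>)
  finally show "bilinear_extension R c f g r = bilinear_extension R (\<lambda>q p. c p q) g f r"
    by (simp add: bilinear_extension_def)
qed

lemma linear_map_bilinear_extension_right:
  assumes c: "\<And>p q. \<lbrakk>p \<in> B; q \<in> B'\<rbrakk> \<Longrightarrow> c p q \<in> B''"
    and f: "f \<in> carrier (free_module R B)"
  shows "linear_map R (free_module R B') (free_module R B'') (bilinear_extension R c f)"
proof -
  have swap: "bilinear_extension R c f g = bilinear_extension R (\<lambda>q p. c p q) g f"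
    if "g \<in> carrier (free_module R B')" for g
    using that f by (intro bilinear_extension_swap) (auto simp: free_module_def)
  have lin: "linear_map R (free_module R B') (free_module R B'')
      (\<lambda>g. bilinear_extension R (\<lambda>q p. c p q) g f)"
    by (rule linear_map_bilinear_extension_left) (use c f in auto)
  interpret V: module R "free_module R B'" by (rule module_free_module)
  show ?thesis
    using lin by (simp add: linear_map_def swap)
qed

lemma bilinear_extension_basis_vector:
  "bilinear_extension R c (basis_vector R p) (basis_vector R q) = basis_vector R (c p q)"
proof
  fix r
  have "{(p', q'). basis_vector R p p' \<noteq> \<zero> \<and> basis_vector R q q' \<noteq> \<zero> \<and> c p' q' = r}
      = (if c p q = r then {(p, q)} else {})"
    by (auto simp: basis_vector_def)
  then show "bilinear_extension R c (basis_vector R p) (basis_vector R q) r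
      = basis_vector R (c p q) r"
    by (simp add: bilinear_extension_def) (auto simp: basis_vector_def)
qed

end


section \<open>Composition of cliques\<close>

lemma clique_ext:
  assumes "\<And>x y. \<lbrakk>1 \<le> x; x < y; y \<le> n + 1\<rbrakk> \<Longrightarrow> p (x, y) = q (x, y)"
    and "p \<in> extensional (arcs n)" "q \<in> extensional (arcs n)"
  shows "p = q"
  by (rule extensionalityI[OF assms(2,3)]) (use assms(1) in \<open>auto simp: arcs_def\<close>)

lemma clique_label:
  assumes "p \<in> cliques M n" "1 \<le> x" "x < y" "y \<le> n + 1"
  shows "p (x, y) \<in> carrier M"
  using assms by (auto simp: cliques_def arcs_def)

lemma clique_comp_extensional:
  "N = n + m - 1 \<Longrightarrow> clique_comp M n m i p q \<in> extensional (arcs N)"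
  unfolding clique_comp_def by (simp add: restrict_extensional)

text \<open>
  Positions and arities are written as successors: the subtractions that remain are those of the
  shifts \<open>i\<close> and \<open>k\<close> from endpoints that are larger than these, so they are never truncated.
\<close>

lemma clique_comp_apply:
  assumes "1 \<le> x" "x < y" "y \<le> n + Suc k"
  shows "clique_comp M n (Suc k) (Suc i) p q (x, y) =
     (if y \<le> Suc i then p (x, y)
     else if x \<le> Suc i \<and> i + k + 2 \<le> y \<and> (x = Suc i \<longrightarrow> y \<noteq> i + k + 2) then p (x, y - k)
     else if i + k + 2 \<le> x then p (x - k, y - k)
     else if Suc i \<le> x \<and> y \<le> i + k + 2 \<and> (x = Suc i \<longrightarrow> y \<noteq> i + k + 2) then q (x - i, y - i)
     else if x = Suc i \<and> y = i + k + 2 then p (Suc i, Suc i + 1) \<otimes>\<^bsub>M\<^esub> q (1, k + 2)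
     else \<one>\<^bsub>M\<^esub>)"
proof -
  from assms have "(x, y) \<in> arcs (n + Suc k - 1)" by (simp add: arcs_def)
  then show ?thesis
    by (simp only: clique_comp_def restrict_apply' split_conv prod.inject)
      (intro if_cong refl;
        use assms(2) in \<open>linarith
          | (intro arg_cong[where f = p], simp only: prod.inject, linarith)
          | (intro arg_cong[where f = q], simp only: prod.inject, linarith)
          | simp\<close>)
qed

lemma nat_interval_cases: "(z::nat) < a \<or> (\<exists>w<d. z = a + w) \<or> \<not> z < a + d"
  by (metis add_less_cancel_left le_iff_add not_less)

lemma nat_above: "\<not> z < (a::nat) \<Longrightarrow> \<exists>w. z = a + w"
  by (metis le_iff_add not_less)

text \<open>
  For the axioms of parallel and of sequential composition, the vertices of the composite polygon
  are divided into seven consecutive ranges. Each vertex is written as the start of its range plus an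
  offset; then all conditions in \<open>clique_comp_apply\<close> are decided, up to the vanishing of offsets,
  and all differences cancel. In the parallel case, \<open>d\<close> is the number of edges of
  the outer clique strictly between the two that are replaced; in the sequential case, it is the
  number of edges of the middle clique after the one that is replaced.
\<close>

lemma clique_comp_parallel_Suc:
  assumes "Suc (i + d) < n"
  shows "clique_comp M (n + k) (Suc l) (Suc (Suc (i + d) + k)) (clique_comp M n (Suc k) (Suc i) p q) r
    = clique_comp M (n + l) (Suc k) (Suc i) (clique_comp M n (Suc l) (Suc (Suc (i + d))) p r) q"
proof (rule clique_ext[where n = "n + k + l"])
  fix x y assume xy: "1 \<le> x" "x < y" "y \<le> (n + k + l) + 1"
  have region: "z < Suc i
      \<or> (\<exists>w<1. z = Suc i + w)
      \<or> (\<exists>w<k. z = Suc i + 1 + w)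
      \<or> (\<exists>w<d. z = Suc i + 1 + k + w)
      \<or> (\<exists>w<1. z = Suc i + 1 + k + d + w)
      \<or> (\<exists>w<l. z = Suc i + 1 + k + d + 1 + w)
      \<or> (\<exists>w. z = Suc i + 1 + k + d + 1 + l + w)" for z
    using nat_interval_cases[of z "Suc i" "1"]
      nat_interval_cases[of z "Suc i + 1" "k"]
      nat_interval_cases[of z "Suc i + 1 + k" "d"]
      nat_interval_cases[of z "Suc i + 1 + k + d" "1"]
      nat_interval_cases[of z "Suc i + 1 + k + d + 1" "l"]
      nat_above[of z "Suc i + 1 + k + d + 1 + l"] by blast
  show "clique_comp M (n + k) (Suc l) (Suc (Suc (i + d) + k)) (clique_comp M n (Suc k) (Suc i) p q) r (x, y)
    = clique_comp M (n + l) (Suc k) (Suc i) (clique_comp M n (Suc l) (Suc (Suc (i + d))) p r) q (x, y)"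
    using region[of x] region[of y]
    by (elim disjE exE conjE)
      (use assms xy in \<open>simp_all add: clique_comp_apply eval_nat_numeral\<close>)
qed (simp_all add: clique_comp_extensional)

lemma clique_comp_sequential_Suc:
  assumes i: "i < n" and p: "p \<in> cliques M n" and q: "q \<in> cliques M (Suc (j + d))" and r: "r \<in> cliques M (Suc l)"
    and M: "unitary_magma M"
  shows "clique_comp M (n + (j + d)) (Suc l) (Suc (i + j)) (clique_comp M n (Suc (j + d)) (Suc i) p q) r
    = clique_comp M n (Suc (j + d + l)) (Suc i) p (clique_comp M (Suc (j + d)) (Suc l) (Suc j) q r)"
proof (rule clique_ext[where n = "n + (j + d) + l"])
  fix x y assume xy: "1 \<le> x" "x < y" "y \<le> (n + (j + d) + l) + 1"
  \<comment> \<open>The three labels meet on one arc only if the middle clique has arity 1.\<close>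
  have assoc: "p (Suc i, Suc (Suc i)) \<otimes>\<^bsub>M\<^esub> q (Suc 0, Suc (Suc 0)) \<otimes>\<^bsub>M\<^esub> r (Suc 0, Suc (Suc l))
    = p (Suc i, Suc (Suc i)) \<otimes>\<^bsub>M\<^esub> (q (Suc 0, Suc (Suc 0)) \<otimes>\<^bsub>M\<^esub> r (Suc 0, Suc (Suc l)))"
    if "j = 0" "d = 0"
  proof -
    have "q (Suc 0, Suc (Suc 0)) = \<one>\<^bsub>M\<^esub>"
      using q that by (simp add: cliques_def eval_nat_numeral)
    moreover have "p (Suc i, Suc (Suc i)) \<in> carrier M" "r (Suc 0, Suc (Suc l)) \<in> carrier M"
      using i by (auto intro!: clique_label[OF p] clique_label[OF r])
    ultimately show ?thesis
      by (simp add: unitary_magma.l_unit[OF M] unitary_magma.r_unit[OF M])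
  qed
  have region: "z < Suc i
      \<or> (\<exists>w<j. z = Suc i + w)
      \<or> (\<exists>w<1. z = Suc i + j + w)
      \<or> (\<exists>w<l. z = Suc i + j + 1 + w)
      \<or> (\<exists>w<d. z = Suc i + j + 1 + l + w)
      \<or> (\<exists>w<1. z = Suc i + j + 1 + l + d + w)
      \<or> (\<exists>w. z = Suc i + j + 1 + l + d + 1 + w)" for z
    using nat_interval_cases[of z "Suc i" "j"]
      nat_interval_cases[of z "Suc i + j" "1"]
      nat_interval_cases[of z "Suc i + j + 1" "l"]
      nat_interval_cases[of z "Suc i + j + 1 + l" "d"]
      nat_interval_cases[of z "Suc i + j + 1 + l + d" "1"]
      nat_above[of z "Suc i + j + 1 + l + d + 1"] by blast
  show "clique_comp M (n + (j + d)) (Suc l) (Suc (i + j)) (clique_comp M n (Suc (j + d)) (Suc i) p q) r (x, y)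
    = clique_comp M n (Suc (j + d + l)) (Suc i) p (clique_comp M (Suc (j + d)) (Suc l) (Suc j) q r) (x, y)"
    using region[of x] region[of y]
    apply (elim disjE exE conjE)
    using i xy
    apply (simp_all add: clique_comp_apply eval_nat_numeral)
    apply (auto simp: assoc)
    done
qed (simp_all add: clique_comp_extensional)


lemma clique_comp_parallel:
  assumes "1 \<le> i" "i < j" "j \<le> n" "1 \<le> m" "1 \<le> l"
  shows "clique_comp M (n + m - 1) l (j + m - 1) (clique_comp M n m i p q) r
    = clique_comp M (n + l - 1) m i (clique_comp M n l j p r) q"
proof -
  define i' d k l' where "i' = i - 1" "d = j - i - 1" "k = m - 1" "l' = l - 1"
  then have *: "i = Suc i'" "j = Suc (Suc (i' + d))" "m = Suc k" "l = Suc l'"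
    using assms by auto
  show ?thesis
    using clique_comp_parallel_Suc[of i' d n M k l' p q r] assms(3) by (simp add: *)
qed

context unitary_magma
begin

lemma clique_comp_closed:
  assumes p: "p \<in> cliques M n" and q: "q \<in> cliques M m" and "1 \<le> i" "i \<le> n" "1 \<le> m"
  shows "clique_comp M n m i p q \<in> cliques M (n + m - 1)"
proof -
  obtain i' k where [simp]: "i = Suc i'" "m = Suc k"
    using assms by (metis Suc_le_D One_nat_def)
  have "clique_comp M n m i p q (x, y) \<in> carrier M" if "(x, y) \<in> arcs (n + m - 1)" for x y
  proof -
    have xy: "1 \<le> x" "x < y" "y \<le> n + Suc k" using that by (auto simp: arcs_def)
    have p': "p (a, b) \<in> carrier M" if "1 \<le> a" "a < b" "b \<le> n + 1" for a b
      by (rule clique_label[OF p that])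
    have q': "q (a, b) \<in> carrier M" if "1 \<le> a" "a < b" "b \<le> k + 2" for a b
      by (rule clique_label[OF q]) (use that in auto)
    \<comment> \<open>Splits the membership of a conditional expression without touching the conditions.\<close>
    have if_mem: "(if c then u else v) \<in> S" if "c \<Longrightarrow> u \<in> S" "\<not> c \<Longrightarrow> v \<in> S"
      for c u v and S :: "'a set"
      using that by simp
    show ?thesis
      unfolding \<open>i = Suc i'\<close> \<open>m = Suc k\<close> clique_comp_apply[OF xy]
      by (intro if_mem p' q' mult_closed one_closed;
          use xy assms(4) \<open>i = Suc i'\<close> in linarith)
  qed
  moreover have "clique_comp M n m i p q (1, 2) = \<one>" if "n + m - 1 = 1"
  proof -
    from that assms have "n = 1" "k = 0" "i' = 0" by auto
    then show ?thesis
      using p q clique_comp_apply[of 1 2 n k M i' p q]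
      by (simp add: cliques_def eval_nat_numeral r_unit one_closed)
  qed
  ultimately show ?thesis
    using clique_comp_extensional[OF refl, of M n m i p q]
    by (auto simp: cliques_def PiE_def)
qed

lemma clique_comp_sequential:
  assumes "p \<in> cliques M n" "q \<in> cliques M m" "r \<in> cliques M l"
    and "1 \<le> i" "i \<le> n" "1 \<le> j" "j \<le> m" "1 \<le> l"
  shows "clique_comp M (n + m - 1) l (i + j - 1) (clique_comp M n m i p q) r
    = clique_comp M n (m + l - 1) i p (clique_comp M m l j q r)"
proof -
  define i' j' d l' where "i' = i - 1" "j' = j - 1" "d = m - j" "l' = l - 1"
  then have *: "i = Suc i'" "j = Suc j'" "m = Suc (j' + d)" "l = Suc l'"
    using assms by auto
  show ?thesis
    using clique_comp_sequential_Suc[of i' n p M q j' d r l'] assms unitary_magma_axioms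
    by (simp add: *)
qed

lemma unit_clique_closed: "unit_clique M \<in> cliques M 1"
  by (auto simp: unit_clique_def cliques_def one_closed arcs_def)

lemma clique_comp_unit_left:
  assumes q: "q \<in> cliques M n" and n: "1 \<le> n"
  shows "clique_comp M 1 n 1 (unit_clique M) q = q"
proof (rule clique_ext[where n = n])
  obtain k where [simp]: "n = Suc k" using n by (metis Suc_le_D One_nat_def)
  fix x y assume xy: "1 \<le> x" "x < y" "y \<le> n + 1"
  then have "q (x, y) \<in> carrier M" by (rule clique_label[OF q])
  then show "clique_comp M 1 n 1 (unit_clique M) q (x, y) = q (x, y)"
    using xy clique_comp_apply[of x y 1 k M 0 "unit_clique M" q]
    by (auto simp: unit_clique_def arcs_def l_unit eval_nat_numeral)
next
  show "q \<in> extensional (arcs n)" using q by (simp add: cliques_def PiE_def)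
  show "clique_comp M 1 n 1 (unit_clique M) q \<in> extensional (arcs n)"
    by (rule clique_comp_extensional) simp
qed

lemma clique_comp_unit_right:
  assumes p: "p \<in> cliques M n" and i: "1 \<le> i" "i \<le> n"
  shows "clique_comp M n 1 i p (unit_clique M) = p"
proof (rule clique_ext[where n = n])
  obtain j where [simp]: "i = Suc j" using i by (metis Suc_le_D One_nat_def)
  fix x y assume xy: "1 \<le> x" "x < y" "y \<le> n + 1"
  then have "p (x, y) \<in> carrier M" by (rule clique_label[OF p])
  then show "clique_comp M n 1 i p (unit_clique M) (x, y) = p (x, y)"
    using xy clique_comp_apply[of x y n 0 M j p "unit_clique M"]
    by (auto simp: unit_clique_def arcs_def r_unit eval_nat_numeral)
next
  show "p \<in> extensional (arcs n)" using p by (simp add: cliques_def PiE_def)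
  show "clique_comp M n 1 i p (unit_clique M) \<in> extensional (arcs n)"
    by (rule clique_comp_extensional) simp
qed

end


section \<open>Nestings are preserved by composition\<close>

lemma not_nesting_free_embedding:
  assumes "\<not> nesting_free M n p"
    and "\<And>a. a \<in> solid_arcs M n p \<Longrightarrow> e a \<in> solid_arcs M N r"
    and "\<And>a a'. nested a' a \<Longrightarrow> nested (e a') (e a)"
    and "inj_on e (solid_arcs M n p)"
  shows "\<not> nesting_free M N r"
  using assms unfolding nesting_free_def inj_on_def by meson

context unitary_magma
begin

lemma not_nesting_free_clique_comp_right:
  assumes ud: "no_nontrivial_unit_divisors M"
    and p: "p \<in> cliques M n" and q: "q \<in> cliques M m" and i: "1 \<le> i" "i \<le> n" and m: "1 \<le> m"
    and nf: "\<not> nesting_free M m q"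
  shows "\<not> nesting_free M (n + m - 1) (clique_comp M n m i p q)"
proof -
  obtain i' k where [simp]: "i = Suc i'" "m = Suc k"
    using i m by (metis Suc_le_D One_nat_def)
  show ?thesis
  proof (rule not_nesting_free_embedding[OF nf, of "\<lambda>(x, y). (x + i', y + i')"])
    fix a assume a: "a \<in> solid_arcs M m q"
    obtain x y where [simp]: "a = (x, y)" by (cases a)
    from a have xy: "1 \<le> x" "x < y" "y \<le> k + 2" and s: "q (x, y) \<noteq> \<one>"
      by (auto simp: solid_arcs_def arcs_def)
    have carr: "p (i, i + 1) \<in> carrier M" "q (x, y) \<in> carrier M"
      using clique_label[OF p, of i "i + 1"] clique_label[OF q, of x y] i xy by auto
    have "clique_comp M n (Suc k) (Suc i') p q (x + i', y + i') =
        (if x = 1 \<and> y = k + 2 then p (i, i + 1) \<otimes> q (x, y) else q (x, y))"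
      using xy i by (subst clique_comp_apply) auto
    moreover have "p (i, i + 1) \<otimes> q (x, y) \<noteq> \<one>"
      using ud s carr by (auto simp: no_nontrivial_unit_divisors_def)
    ultimately have "clique_comp M n m i p q (x + i', y + i') \<noteq> \<one>"
      using s by auto
    then show "(case a of (x, y) \<Rightarrow> (x + i', y + i'))
        \<in> solid_arcs M (n + m - 1) (clique_comp M n m i p q)"
      using xy i by (simp add: solid_arcs_def arcs_def)
  qed (auto simp: nested_def inj_on_def)
qed

lemma not_nesting_free_clique_comp_left:
  assumes ud: "no_nontrivial_unit_divisors M"
    and p: "p \<in> cliques M n" and q: "q \<in> cliques M m" and i: "1 \<le> i" "i \<le> n" and m: "1 \<le> m"
    and nf: "\<not> nesting_free M n p"
  shows "\<not> nesting_free M (n + m - 1) (clique_comp M n m i p q)"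
proof -
  obtain i' k where [simp]: "i = Suc i'" "m = Suc k"
    using i m by (metis Suc_le_D One_nat_def)
  \<comment> \<open>The vertices after \<open>i\<close> make room for the \<open>m - 1 = k\<close> inner vertices of \<open>q\<close>.\<close>
  define s where "s z = (if z \<le> i then z else z + k)" for z
  have s_less: "s z < s z' \<longleftrightarrow> z < z'" for z z' by (auto simp: s_def)
  have s_le: "s z \<le> s z' \<longleftrightarrow> z \<le> z'" for z z' by (auto simp: s_def)
  have s_eq: "s z = s z' \<longleftrightarrow> z = z'" for z z' by (auto simp: s_def)
  show ?thesis
  proof (rule not_nesting_free_embedding[OF nf, of "\<lambda>(x, y). (s x, s y)"])
    fix a assume a: "a \<in> solid_arcs M n p"
    obtain x y where [simp]: "a = (x, y)" by (cases a)
    from a have xy: "1 \<le> x" "x < y" "y \<le> n + 1" and solid: "p (x, y) \<noteq> \<one>"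
      by (auto simp: solid_arcs_def arcs_def)
    have carr: "p (x, y) \<in> carrier M" "q (1, k + 2) \<in> carrier M"
      using clique_label[OF p, of x y] clique_label[OF q, of 1 "k + 2"] xy by auto
    have sxy: "1 \<le> s x" "s x < s y" "s y \<le> n + Suc k"
      using xy by (auto simp: s_def)
    have "clique_comp M n (Suc k) (Suc i') p q (s x, s y) =
        (if x = i \<and> y = i + 1 then p (x, y) \<otimes> q (1, k + 2) else p (x, y))"
      unfolding clique_comp_apply[OF sxy] using xy i by (auto simp: s_def)
    moreover have "p (x, y) \<otimes> q (1, k + 2) \<noteq> \<one>"
      using ud solid carr by (auto simp: no_nontrivial_unit_divisors_def)
    ultimately have "clique_comp M n m i p q (s x, s y) \<noteq> \<one>"
      using solid by auto
    then show "(case a of (x, y) \<Rightarrow> (s x, s y))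
        \<in> solid_arcs M (n + m - 1) (clique_comp M n m i p q)"
      using sxy by (simp add: solid_arcs_def arcs_def)
  qed (auto simp: nested_def inj_on_def s_less s_le s_eq)
qed

end


section \<open>Quotients of operads by ideals\<close>

lemma (in module) abelian_subgroup_submodule:
  assumes "submodule H R M"
  shows "abelian_subgroup H M"
  by (rule abelian_subgroupI3)
    (auto intro: additive_subgroupI submodule.axioms(1)[OF assms] M.abelian_group_axioms)

lemma (in module) coset_eqI:
  assumes H: "submodule H R M" and "h \<in> H" "x \<in> carrier M" "y = h \<oplus>\<^bsub>M\<^esub> x"
  shows "H +>\<^bsub>M\<^esub> y = H +>\<^bsub>M\<^esub> x"
proof -
  have "y \<in> H +>\<^bsub>M\<^esub> x" using assms by (auto simp: a_r_coset_def')
  then show ?thesis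
    using M.a_repr_independence[OF _ assms(3) submodule.axioms(1)[OF H]] by simp
qed

lemma (in module) mem_cosetE:
  assumes "y \<in> H +>\<^bsub>M\<^esub> x"
  obtains h where "h \<in> H" "y = h \<oplus>\<^bsub>M\<^esub> x"
  using assms by (auto simp: a_r_coset_def')

lemma (in module) coset_nonempty:
  assumes "submodule H R M" "x \<in> carrier M"
  shows "H +>\<^bsub>M\<^esub> x \<noteq> {}"
  using abelian_subgroup.a_rcos_self[OF abelian_subgroup_submodule] assms by blast

lemma quotient_module_simps:
  fixes V :: "('k, 'v) module"
  assumes V: "module R V" and H: "submodule H R V"
  shows carrier_quotient_module: "carrier (quotient_module V H) = (\<lambda>x. H +>\<^bsub>V\<^esub> x) ` carrier V"
    and zero_quotient_module: "\<zero>\<^bsub>quotient_module V H\<^esub> = H +>\<^bsub>V\<^esub> \<zero>\<^bsub>V\<^esub>"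
    and add_quotient_module: "\<And>x y. \<lbrakk>x \<in> carrier V; y \<in> carrier V\<rbrakk>
      \<Longrightarrow> (H +>\<^bsub>V\<^esub> x) \<oplus>\<^bsub>quotient_module V H\<^esub> (H +>\<^bsub>V\<^esub> y) = H +>\<^bsub>V\<^esub> (x \<oplus>\<^bsub>V\<^esub> y)"
    and smult_quotient_module: "\<And>a x. \<lbrakk>a \<in> carrier R; x \<in> carrier V\<rbrakk>
      \<Longrightarrow> a \<odot>\<^bsub>quotient_module V H\<^esub> (H +>\<^bsub>V\<^esub> x) = H +>\<^bsub>V\<^esub> (a \<odot>\<^bsub>V\<^esub> x)"
proof -
  interpret M: module R V by (rule V)
  interpret H: abelian_subgroup H V by (rule M.abelian_subgroup_submodule[OF H])
  show "carrier (quotient_module V H) = (\<lambda>x. H +>\<^bsub>V\<^esub> x) ` carrier V"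
    by (auto simp: quotient_module_def A_RCOSETS_def')
  show "\<zero>\<^bsub>quotient_module V H\<^esub> = H +>\<^bsub>V\<^esub> \<zero>\<^bsub>V\<^esub>"
    using H.a_subset by (simp add: quotient_module_def)
  show "(H +>\<^bsub>V\<^esub> x) \<oplus>\<^bsub>quotient_module V H\<^esub> (H +>\<^bsub>V\<^esub> y) = H +>\<^bsub>V\<^esub> (x \<oplus>\<^bsub>V\<^esub> y)"
    if "x \<in> carrier V" "y \<in> carrier V" for x y
    using H.a_rcos_sum[OF that] by (simp add: quotient_module_def)
  show "a \<odot>\<^bsub>quotient_module V H\<^esub> (H +>\<^bsub>V\<^esub> x) = H +>\<^bsub>V\<^esub> (a \<odot>\<^bsub>V\<^esub> x)"
    if a: "a \<in> carrier R" and x: "x \<in> carrier V" for a x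
  proof -
    have "H +>\<^bsub>V\<^esub> (a \<odot>\<^bsub>V\<^esub> y) = H +>\<^bsub>V\<^esub> (a \<odot>\<^bsub>V\<^esub> x)" if y: "y \<in> H +>\<^bsub>V\<^esub> x" for y
    proof -
      obtain h where h: "h \<in> H" "y = h \<oplus>\<^bsub>V\<^esub> x" using y by (rule M.mem_cosetE)
      then have "a \<odot>\<^bsub>V\<^esub> y = a \<odot>\<^bsub>V\<^esub> h \<oplus>\<^bsub>V\<^esub> a \<odot>\<^bsub>V\<^esub> x"
        using a x H.a_subset by (auto intro: M.smult_r_distr)
      then show ?thesis
        using a x h submodule.smult_closed[OF H] by (intro M.coset_eqI[OF H]) auto
    qed
    then show ?thesis
      using M.coset_nonempty[OF H x] by (simp add: quotient_module_def)
  qed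
qed

lemma module_quotient_module:
  fixes V :: "('k, 'v) module"
  assumes V: "module R V" and H: "submodule H R V"
  shows "module R (quotient_module V H)"
proof -
  interpret M: module R V by (rule V)
  let ?Q = "quotient_module V H"
  note Q = quotient_module_simps[OF V H]
  have "abelian_group ?Q"
  proof (rule abelian_groupI)
    fix X assume "X \<in> carrier ?Q"
    then obtain x where x: "x \<in> carrier V" "X = H +>\<^bsub>V\<^esub> x" by (auto simp: Q)
    then have "(H +>\<^bsub>V\<^esub> (\<ominus>\<^bsub>V\<^esub> x)) \<oplus>\<^bsub>?Q\<^esub> X = \<zero>\<^bsub>?Q\<^esub>"
      by (simp add: Q(2,3) M.M.l_neg del: M.M.a_coset_add_zero)
    with x show "\<exists>Y\<in>carrier ?Q. Y \<oplus>\<^bsub>?Q\<^esub> X = \<zero>\<^bsub>?Q\<^esub>"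
      by (auto simp: Q(1))
  qed (auto simp: Q M.M.a_ac simp del: M.M.a_coset_add_zero)
  then show ?thesis
    by (rule moduleI[OF M.R.is_cring])
      (auto simp: Q M.smult_l_distr M.smult_r_distr M.smult_assoc1)
qed

context operad_ideal
begin

text \<open>
  Composition of cosets does not depend on the representatives: the composition of
  \<open>g \<oplus> x\<close> with \<open>h \<oplus> y\<close>, where \<open>g\<close> and \<open>h\<close> lie in the ideal, differs from that of \<open>x\<close> with \<open>y\<close> by
  the two terms \<open>g \<circ>\<^sub>i (h \<oplus> y)\<close> and \<open>x \<circ>\<^sub>i h\<close>, which lie in the ideal.
\<close>

lemma pcomp_quotient_operad:
  assumes x: "x \<in> carrier (component P n)" and y: "y \<in> carrier (component P m)"
    and i: "1 \<le> i" "i \<le> n" and m: "1 \<le> m"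
  shows "pcomp (quotient_operad P I) n m i
      (I n +>\<^bsub>component P n\<^esub> x) (I m +>\<^bsub>component P m\<^esub> y)
    = I (n + m - 1) +>\<^bsub>component P (n + m - 1)\<^esub> pcomp P n m i x y"
proof -
  let ?N = "n + m - 1"
  have n: "1 \<le> n" and N: "1 \<le> ?N" using i m by auto
  interpret Vn: module K "component P n" by (rule module_component[OF n])
  interpret Vm: module K "component P m" by (rule module_component[OF m])
  interpret VN: module K "component P ?N" by (rule module_component[OF N])
  note In = graded_subspace[OF n] and Im = graded_subspace[OF m] and IN = graded_subspace[OF N]
  have "I ?N +>\<^bsub>component P ?N\<^esub> pcomp P n m i x' y'
      = I ?N +>\<^bsub>component P ?N\<^esub> pcomp P n m i x y"
    if x': "x' \<in> I n +>\<^bsub>component P n\<^esub> x" and y': "y' \<in> I m +>\<^bsub>component P m\<^esub> y" for x' y'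
  proof -
    obtain g where g: "g \<in> I n" "x' = g \<oplus>\<^bsub>component P n\<^esub> x" using x' by (rule Vn.mem_cosetE)
    obtain h where h: "h \<in> I m" "y' = h \<oplus>\<^bsub>component P m\<^esub> y" using y' by (rule Vm.mem_cosetE)
    have gV: "g \<in> carrier (component P n)" and hV: "h \<in> carrier (component P m)"
      using Vn.submoduleE(1)[OF In] Vm.submoduleE(1)[OF Im] g h by auto
    have y'V: "y' \<in> carrier (component P m)" using h hV y by simp
    have gI: "pcomp P n m i g y' \<in> I ?N"
      using pcomp_ideal_left[OF g(1) y'V] i m by simp
    have hI: "pcomp P n m i x h \<in> I ?N"
      using pcomp_ideal_right[OF x h(1)] i m by simp
    have "pcomp P n m i x' y'
        = pcomp P n m i g y' \<oplus>\<^bsub>component P ?N\<^esub> pcomp P n m i x y'"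
      using g gV x y'V i m by (simp add: pcomp_add_left)
    also have "pcomp P n m i x y'
        = pcomp P n m i x h \<oplus>\<^bsub>component P ?N\<^esub> pcomp P n m i x y"
      using h hV x y i m by (simp add: pcomp_add_right)
    finally have "pcomp P n m i x' y' = (pcomp P n m i g y' \<oplus>\<^bsub>component P ?N\<^esub> pcomp P n m i x h)
        \<oplus>\<^bsub>component P ?N\<^esub> pcomp P n m i x y"
      using gV hV x y y'V i m by (simp only: VN.M.a_assoc pcomp_closed)
    moreover have "pcomp P n m i g y' \<oplus>\<^bsub>component P ?N\<^esub> pcomp P n m i x h \<in> I ?N"
      by (rule VN.submoduleE(5)[OF IN gI hI])
    ultimately show ?thesis
      by (intro VN.coset_eqI[OF IN _ pcomp_closed[OF x y i m]])
  qed
  then show ?thesis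
    using Vn.coset_nonempty[OF In x] Vm.coset_nonempty[OF Im y]
    by (simp add: quotient_operad_def)
qed

lemma ns_operad_quotient_operad: "ns_operad K (quotient_operad P I)"
proof -
  let ?Q = "quotient_operad P I"
  have comp: "component ?Q n = quotient_module (component P n) (I n)" for n
    by (simp add: quotient_operad_def)
  have carr: "carrier (component ?Q n)
      = (\<lambda>x. I n +>\<^bsub>component P n\<^esub> x) ` carrier (component P n)" if "1 \<le> n" for n
    unfolding comp
    by (rule carrier_quotient_module[OF module_component[OF that] graded_subspace[OF that]])
  have add: "(I n +>\<^bsub>component P n\<^esub> x) \<oplus>\<^bsub>component ?Q n\<^esub> (I n +>\<^bsub>component P n\<^esub> y)
      = I n +>\<^bsub>component P n\<^esub> (x \<oplus>\<^bsub>component P n\<^esub> y)"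
    if "1 \<le> n" "x \<in> carrier (component P n)" "y \<in> carrier (component P n)" for n x y
    unfolding comp
    by (rule add_quotient_module[OF module_component[OF that(1)] graded_subspace[OF that(1)]
          that(2,3)])
  have smult: "a \<odot>\<^bsub>component ?Q n\<^esub> (I n +>\<^bsub>component P n\<^esub> x)
      = I n +>\<^bsub>component P n\<^esub> (a \<odot>\<^bsub>component P n\<^esub> x)"
    if "1 \<le> n" "a \<in> carrier K" "x \<in> carrier (component P n)" for n a x
    unfolding comp
    by (rule smult_quotient_module[OF module_component[OF that(1)] graded_subspace[OF that(1)]
          that(2,3)])
  have add_closed: "x \<oplus>\<^bsub>component P n\<^esub> y \<in> carrier (component P n)"
    if "1 \<le> n" "x \<in> carrier (component P n)" "y \<in> carrier (component P n)" for n x y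
  proof -
    interpret module K "component P n" by (rule module_component[OF that(1)])
    show ?thesis using that by simp
  qed
  have smult_closed: "a \<odot>\<^bsub>component P n\<^esub> x \<in> carrier (component P n)"
    if "1 \<le> n" "a \<in> carrier K" "x \<in> carrier (component P n)" for n a x
    using that by (intro module.smult_closed[OF module_component])
  have unit: "operad_unit ?Q = I 1 +>\<^bsub>component P 1\<^esub> operad_unit P"
    by (simp add: quotient_operad_def)
  note simps = pcomp_quotient_operad pcomp_closed add smult add_closed smult_closed
  show ?thesis
  proof (intro ns_operad.intro ns_operad_axioms.intro field_axioms)
    fix n :: nat assume "1 \<le> n"
    then show "module K (component ?Q n)"
      unfolding comp by (intro module_quotient_module module_component graded_subspace)
  next
    fix X Y n m i
    assume A: "X \<in> carrier (component ?Q n)" "Y \<in> carrier (component ?Q m)"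
      and i: "1 \<le> i" "i \<le> n" "1 \<le> m"
    then have n: "1 \<le> n" and N: "1 \<le> n + m - 1" by auto
    obtain x y where "x \<in> carrier (component P n)" "X = I n +>\<^bsub>component P n\<^esub> x"
        "y \<in> carrier (component P m)" "Y = I m +>\<^bsub>component P m\<^esub> y"
      using A unfolding carr[OF n] carr[OF i(3)] by blast
    then show "pcomp ?Q n m i X Y \<in> carrier (component ?Q (n + m - 1))"
      using i unfolding carr[OF N] by (simp only: pcomp_quotient_operad pcomp_closed imageI)
  next
    fix X X' Y n m i
    assume A: "X \<in> carrier (component ?Q n)" "X' \<in> carrier (component ?Q n)"
        "Y \<in> carrier (component ?Q m)"
      and i: "1 \<le> i" "i \<le> n" "1 \<le> m"
    then have n: "1 \<le> n" and N: "1 \<le> n + m - 1" by auto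
    obtain x x' y where "x \<in> carrier (component P n)" "X = I n +>\<^bsub>component P n\<^esub> x"
        "x' \<in> carrier (component P n)" "X' = I n +>\<^bsub>component P n\<^esub> x'"
        "y \<in> carrier (component P m)" "Y = I m +>\<^bsub>component P m\<^esub> y"
      using A unfolding carr[OF n] carr[OF i(3)] by blast
    then show "pcomp ?Q n m i (X \<oplus>\<^bsub>component ?Q n\<^esub> X') Y
        = pcomp ?Q n m i X Y \<oplus>\<^bsub>component ?Q (n + m - 1)\<^esub> pcomp ?Q n m i X' Y"
      using i n N by (simp only: simps pcomp_add_left)
  next
    fix X Y Y' n m i
    assume A: "X \<in> carrier (component ?Q n)" "Y \<in> carrier (component ?Q m)"
        "Y' \<in> carrier (component ?Q m)"
      and i: "1 \<le> i" "i \<le> n" "1 \<le> m"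
    then have n: "1 \<le> n" and N: "1 \<le> n + m - 1" by auto
    obtain x y y' where "x \<in> carrier (component P n)" "X = I n +>\<^bsub>component P n\<^esub> x"
        "y \<in> carrier (component P m)" "Y = I m +>\<^bsub>component P m\<^esub> y"
        "y' \<in> carrier (component P m)" "Y' = I m +>\<^bsub>component P m\<^esub> y'"
      using A unfolding carr[OF n] carr[OF i(3)] by blast
    then show "pcomp ?Q n m i X (Y \<oplus>\<^bsub>component ?Q m\<^esub> Y')
        = pcomp ?Q n m i X Y \<oplus>\<^bsub>component ?Q (n + m - 1)\<^esub> pcomp ?Q n m i X Y'"
      using i n N by (simp only: simps pcomp_add_right)
  next
    fix a X Y n m i
    assume a: "a \<in> carrier K"
      and A: "X \<in> carrier (component ?Q n)" "Y \<in> carrier (component ?Q m)"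
      and i: "1 \<le> i" "i \<le> n" "1 \<le> m"
    then have n: "1 \<le> n" and N: "1 \<le> n + m - 1" by auto
    obtain x y where "x \<in> carrier (component P n)" "X = I n +>\<^bsub>component P n\<^esub> x"
        "y \<in> carrier (component P m)" "Y = I m +>\<^bsub>component P m\<^esub> y"
      using A unfolding carr[OF n] carr[OF i(3)] by blast
    then show "pcomp ?Q n m i (a \<odot>\<^bsub>component ?Q n\<^esub> X) Y
        = a \<odot>\<^bsub>component ?Q (n + m - 1)\<^esub> pcomp ?Q n m i X Y"
      and "pcomp ?Q n m i X (a \<odot>\<^bsub>component ?Q m\<^esub> Y)
        = a \<odot>\<^bsub>component ?Q (n + m - 1)\<^esub> pcomp ?Q n m i X Y"
      using a i n N by (simp_all only: simps pcomp_smult_left pcomp_smult_right)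
  next
    fix X Y Z n m l i j
    assume A: "X \<in> carrier (component ?Q n)" "Y \<in> carrier (component ?Q m)"
        "Z \<in> carrier (component ?Q l)"
      and i: "1 \<le> i" "i \<le> n" "1 \<le> j" "j \<le> m" "1 \<le> l"
    then have n: "1 \<le> n" "1 \<le> m"
      and N: "1 \<le> i + j - 1" "i + j - 1 \<le> n + m - 1" "1 \<le> m + l - 1"
        "n + m - 1 + l - 1 = n + (m + l - 1) - 1" by auto
    obtain x y z where "x \<in> carrier (component P n)" "X = I n +>\<^bsub>component P n\<^esub> x"
        "y \<in> carrier (component P m)" "Y = I m +>\<^bsub>component P m\<^esub> y"
        "z \<in> carrier (component P l)" "Z = I l +>\<^bsub>component P l\<^esub> z"
      using A unfolding carr[OF n(1)] carr[OF n(2)] carr[OF i(5)] by blast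
    then show "pcomp ?Q (n + m - 1) l (i + j - 1) (pcomp ?Q n m i X Y) Z
        = pcomp ?Q n (m + l - 1) i X (pcomp ?Q m l j Y Z)"
      using i n N by (simp only: simps pcomp_sequential)
  next
    fix X Y Z n m l i j
    assume A: "X \<in> carrier (component ?Q n)" "Y \<in> carrier (component ?Q m)"
        "Z \<in> carrier (component ?Q l)"
      and i: "1 \<le> i" "i < j" "j \<le> n" "1 \<le> m" "1 \<le> l"
    then have n: "1 \<le> n" "i \<le> n" "1 \<le> j"
      and N: "1 \<le> j + m - 1" "j + m - 1 \<le> n + m - 1" "i \<le> n + l - 1"
        "n + m - 1 + l - 1 = n + l - 1 + m - 1" by auto
    obtain x y z where "x \<in> carrier (component P n)" "X = I n +>\<^bsub>component P n\<^esub> x"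
        "y \<in> carrier (component P m)" "Y = I m +>\<^bsub>component P m\<^esub> y"
        "z \<in> carrier (component P l)" "Z = I l +>\<^bsub>component P l\<^esub> z"
      using A unfolding carr[OF n(1)] carr[OF i(4)] carr[OF i(5)] by blast
    then show "pcomp ?Q (n + m - 1) l (j + m - 1) (pcomp ?Q n m i X Y) Z
        = pcomp ?Q (n + l - 1) m i (pcomp ?Q n l j X Z) Y"
      using i n N by (simp only: simps pcomp_parallel)
  next
    show "operad_unit ?Q \<in> carrier (component ?Q 1)"
      unfolding carr[OF order_refl] unit by (intro imageI unit_closed)
  next
    fix X n
    assume A: "X \<in> carrier (component ?Q n)" and n: "1 \<le> n"
    then obtain x where "x \<in> carrier (component P n)" "X = I n +>\<^bsub>component P n\<^esub> x"
      unfolding carr[OF n] by blast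
    then show "pcomp ?Q 1 n 1 (operad_unit ?Q) X = X"
      using n by (simp only: unit pcomp_quotient_operad unit_closed order_refl unit_left
        add_diff_cancel_left')
  next
    fix X n i
    assume A: "X \<in> carrier (component ?Q n)" and i: "1 \<le> i" "i \<le> n"
    then have n: "1 \<le> n" by simp
    with A obtain x where "x \<in> carrier (component P n)" "X = I n +>\<^bsub>component P n\<^esub> x"
      unfolding carr[OF n] by blast
    then show "pcomp ?Q n 1 i X (operad_unit ?Q) = X"
      using i by (simp only: unit pcomp_quotient_operad unit_closed order_refl unit_right
        add_diff_cancel_right')
  qed
qed

end


section \<open>The operad of cliques and the ideal of nested cliques\<close>

text \<open>The data from which the operad of cliques is built.\<close>

locale clique_operad_data = K?: field K + unitary_magma M
  for K :: "('k, 'z) ring_scheme" and M :: "('m, 'y) monoid_scheme"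
begin

text \<open>The component of arity \<open>n\<close> of the operad of cliques.\<close>

abbreviation V :: "nat \<Rightarrow> ('k, (nat \<times> nat \<Rightarrow> 'm) \<Rightarrow> 'k) module" where
  "V n \<equiv> free_module K (cliques M n)"

text \<open>The partial composition at position \<open>i\<close> of arities \<open>n\<close> and \<open>m\<close> in the operad of cliques.\<close>

abbreviation pc where "pc n m i \<equiv> bilinear_extension K (clique_comp M n m i)"

lemma clique_operad_simps:
  "component (clique_operad K M) n = V n"
  "pcomp (clique_operad K M) n m i = pc n m i"
  "operad_unit (clique_operad K M) = basis_vector K (unit_clique M)"
  by (simp_all add: clique_operad_def bilinear_extension_def fun_eq_iff)

text \<open>
  The target arity \<open>N\<close> is a separate variable because iterated compositions reach the same arity
  through different expressions.
\<close>

lemma linear_map_pc_left: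
  assumes "y \<in> carrier (V m)" "1 \<le> i" "i \<le> n" "1 \<le> m" "N = n + m - 1"
  shows "linear_map K (V n) (V N) (\<lambda>x. pc n m i x y)"
  unfolding \<open>N = n + m - 1\<close> using assms(1-4)
  by (intro linear_map_bilinear_extension_left clique_comp_closed)

lemma linear_map_pc_right:
  assumes "x \<in> carrier (V n)" "1 \<le> i" "i \<le> n" "1 \<le> m" "N = n + m - 1"
  shows "linear_map K (V m) (V N) (pc n m i x)"
  unfolding \<open>N = n + m - 1\<close> using assms(1-4)
  by (intro linear_map_bilinear_extension_right clique_comp_closed)

lemma pc_closed:
  assumes "x \<in> carrier (V n)" "y \<in> carrier (V m)" "1 \<le> i" "i \<le> n" "1 \<le> m" "N = n + m - 1"
  shows "pc n m i x y \<in> carrier (V N)"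
  by (rule linear_map_closed[OF linear_map_pc_left[OF assms(2-6)] assms(1)])

lemma pc_sequential:
  assumes x: "x \<in> carrier (V n)" and y: "y \<in> carrier (V m)" and z: "z \<in> carrier (V l)"
    and ij: "1 \<le> i" "i \<le> n" "1 \<le> j" "j \<le> m" "1 \<le> l"
  shows "pc (n + m - 1) l (i + j - 1) (pc n m i x y) z = pc n (m + l - 1) i x (pc m l j y z)"
proof -
  let ?W = "V (n + m - 1 + l - 1)"
  have ar: "1 \<le> i + j - 1" "i + j - 1 \<le> n + m - 1" "1 \<le> m" "1 \<le> m + l - 1"
    "n + m - 1 + l - 1 = n + (m + l - 1) - 1"
    using ij by auto
  show ?thesis
  proof (rule trilinear_eqI[OF module_free_module _ _ _ _ _ _ _ x y z,
        of "cliques M (n + m - 1 + l - 1)"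
          "\<lambda>x y z. pc (n + m - 1) l (i + j - 1) (pc n m i x y) z"
          "\<lambda>x y z. pc n (m + l - 1) i x (pc m l j y z)"])
    fix y z assume "y \<in> carrier (V m)" "z \<in> carrier (V l)"
    show "linear_map K (V n) ?W (\<lambda>x. pc (n + m - 1) l (i + j - 1) (pc n m i x y) z)"
      by (rule linear_map_compose[OF linear_map_pc_left linear_map_pc_left];
          (rule pc_closed)?; (fact | rule refl))
    show "linear_map K (V n) ?W (\<lambda>x. pc n (m + l - 1) i x (pc m l j y z))"
      by (rule linear_map_pc_left;
          (rule pc_closed)?; (fact | rule refl))
  next
    fix x z assume "x \<in> carrier (V n)" "z \<in> carrier (V l)"
    show "linear_map K (V m) ?W (\<lambda>y. pc (n + m - 1) l (i + j - 1) (pc n m i x y) z)"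
      by (rule linear_map_compose[OF linear_map_pc_right linear_map_pc_left];
          (rule pc_closed)?; (fact | rule refl))
    show "linear_map K (V m) ?W (\<lambda>y. pc n (m + l - 1) i x (pc m l j y z))"
      by (rule linear_map_compose[OF linear_map_pc_left linear_map_pc_right];
          (rule pc_closed)?; (fact | rule refl))
  next
    fix x y assume "x \<in> carrier (V n)" "y \<in> carrier (V m)"
    show "linear_map K (V l) ?W (\<lambda>z. pc (n + m - 1) l (i + j - 1) (pc n m i x y) z)"
      by (rule linear_map_pc_right;
          (rule pc_closed)?; (fact | rule refl))
    show "linear_map K (V l) ?W (\<lambda>z. pc n (m + l - 1) i x (pc m l j y z))"
      by (rule linear_map_compose[OF linear_map_pc_right linear_map_pc_right];
          (rule pc_closed)?; (fact | rule refl))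
  next
    fix p q r assume "p \<in> cliques M n" "q \<in> cliques M m" "r \<in> cliques M l"
    then show "pc (n + m - 1) l (i + j - 1)
        (pc n m i (basis_vector K p) (basis_vector K q)) (basis_vector K r)
      = pc n (m + l - 1) i (basis_vector K p) (pc m l j (basis_vector K q) (basis_vector K r))"
      using ij by (simp only: bilinear_extension_basis_vector clique_comp_sequential)
  qed
qed

lemma pc_parallel:
  assumes x: "x \<in> carrier (V n)" and y: "y \<in> carrier (V m)" and z: "z \<in> carrier (V l)"
    and ij: "1 \<le> i" "i < j" "j \<le> n" "1 \<le> m" "1 \<le> l"
  shows "pc (n + m - 1) l (j + m - 1) (pc n m i x y) z = pc (n + l - 1) m i (pc n l j x z) y"
proof -
  let ?W = "V (n + m - 1 + l - 1)"
  have ar: "i \<le> n" "1 \<le> j" "1 \<le> j + m - 1" "j + m - 1 \<le> n + m - 1" "i \<le> n + l - 1"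
    "n + m - 1 + l - 1 = n + l - 1 + m - 1"
    using ij by auto
  show ?thesis
  proof (rule trilinear_eqI[OF module_free_module _ _ _ _ _ _ _ x y z,
        of "cliques M (n + m - 1 + l - 1)"
          "\<lambda>x y z. pc (n + m - 1) l (j + m - 1) (pc n m i x y) z"
          "\<lambda>x y z. pc (n + l - 1) m i (pc n l j x z) y"])
    fix y z assume "y \<in> carrier (V m)" "z \<in> carrier (V l)"
    show "linear_map K (V n) ?W (\<lambda>x. pc (n + m - 1) l (j + m - 1) (pc n m i x y) z)"
      by (rule linear_map_compose[OF linear_map_pc_left linear_map_pc_left];
          (rule pc_closed)?; (fact | rule refl))
    show "linear_map K (V n) ?W (\<lambda>x. pc (n + l - 1) m i (pc n l j x z) y)"
      by (rule linear_map_compose[OF linear_map_pc_left linear_map_pc_left];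
          (rule pc_closed)?; (fact | rule refl))
  next
    fix x z assume "x \<in> carrier (V n)" "z \<in> carrier (V l)"
    show "linear_map K (V m) ?W (\<lambda>y. pc (n + m - 1) l (j + m - 1) (pc n m i x y) z)"
      by (rule linear_map_compose[OF linear_map_pc_right linear_map_pc_left];
          (rule pc_closed)?; (fact | rule refl))
    show "linear_map K (V m) ?W (\<lambda>y. pc (n + l - 1) m i (pc n l j x z) y)"
      by (rule linear_map_pc_right;
          (rule pc_closed)?; (fact | rule refl))
  next
    fix x y assume "x \<in> carrier (V n)" "y \<in> carrier (V m)"
    show "linear_map K (V l) ?W (\<lambda>z. pc (n + m - 1) l (j + m - 1) (pc n m i x y) z)"
      by (rule linear_map_pc_right;
          (rule pc_closed)?; (fact | rule refl))
    show "linear_map K (V l) ?W (\<lambda>z. pc (n + l - 1) m i (pc n l j x z) y)"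
      by (rule linear_map_compose[OF linear_map_pc_right linear_map_pc_left];
          (rule pc_closed)?; (fact | rule refl))
  next
    fix p q r
    show "pc (n + m - 1) l (j + m - 1)
        (pc n m i (basis_vector K p) (basis_vector K q)) (basis_vector K r)
      = pc (n + l - 1) m i (pc n l j (basis_vector K p) (basis_vector K r)) (basis_vector K q)"
      using ij by (simp only: bilinear_extension_basis_vector clique_comp_parallel)
  qed
qed

lemma ns_operad_clique_operad: "ns_operad K (clique_operad K M)"
proof (intro ns_operad.intro ns_operad_axioms.intro field_axioms;
    (unfold clique_operad_simps)?)
  show "module K (V n)" for n by (rule module_free_module)
  show "pc n m i x y \<in> carrier (V (n + m - 1))"
    if "x \<in> carrier (V n)" "y \<in> carrier (V m)" "1 \<le> i" "i \<le> n" "1 \<le> m" for x y n m i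
    by (rule pc_closed[OF that refl])
  show "pc n m i (x \<oplus>\<^bsub>V n\<^esub> x') y = pc n m i x y \<oplus>\<^bsub>V (n + m - 1)\<^esub> pc n m i x' y"
    if "x \<in> carrier (V n)" "x' \<in> carrier (V n)" "y \<in> carrier (V m)" "1 \<le> i" "i \<le> n" "1 \<le> m"
    for x x' y n m i
    by (rule linear_map_add[OF linear_map_pc_left[OF that(3-6) refl] that(1,2)])
  show "pc n m i x (y \<oplus>\<^bsub>V m\<^esub> y') = pc n m i x y \<oplus>\<^bsub>V (n + m - 1)\<^esub> pc n m i x y'"
    if "x \<in> carrier (V n)" "y \<in> carrier (V m)" "y' \<in> carrier (V m)" "1 \<le> i" "i \<le> n" "1 \<le> m"
    for x y y' n m i
    by (rule linear_map_add[OF linear_map_pc_right[OF that(1,4-6) refl] that(2,3)])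
  show "pc n m i (a \<odot>\<^bsub>V n\<^esub> x) y = a \<odot>\<^bsub>V (n + m - 1)\<^esub> pc n m i x y"
    if "a \<in> carrier K" "x \<in> carrier (V n)" "y \<in> carrier (V m)" "1 \<le> i" "i \<le> n" "1 \<le> m"
    for a x y n m i
    by (rule linear_map_smult[OF linear_map_pc_left[OF that(3-6) refl] that(1,2)])
  show "pc n m i x (a \<odot>\<^bsub>V m\<^esub> y) = a \<odot>\<^bsub>V (n + m - 1)\<^esub> pc n m i x y"
    if "a \<in> carrier K" "x \<in> carrier (V n)" "y \<in> carrier (V m)" "1 \<le> i" "i \<le> n" "1 \<le> m"
    for a x y n m i
    by (rule linear_map_smult[OF linear_map_pc_right[OF that(2,4-6) refl] that(1,3)])
  show "basis_vector K (unit_clique M) \<in> carrier (V 1)"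
    by (intro basis_vector_closed unit_clique_closed)
  then show "pc 1 n 1 (basis_vector K (unit_clique M)) x = x"
    if x: "x \<in> carrier (V n)" and n: "1 \<le> n" for x n
    by (intro linear_map_eqI[OF module_free_module linear_map_pc_right linear_map_id _ x])
      (use n in \<open>simp_all only: bilinear_extension_basis_vector clique_comp_unit_left
        order_refl add_diff_cancel_left'\<close>)
  show "pc n 1 i x (basis_vector K (unit_clique M)) = x"
    if x: "x \<in> carrier (V n)" and i: "1 \<le> i" "i \<le> n" for x n i
    by (intro linear_map_eqI[OF module_free_module linear_map_pc_left linear_map_id _ x]
        basis_vector_closed unit_clique_closed)
      (use i in \<open>simp_all only: bilinear_extension_basis_vector clique_comp_unit_right
        order_refl add_diff_cancel_right'\<close>)
qed (fact pc_sequential pc_parallel)+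

lemma nes_relations_eq_hull:
  "nes_relations K M n = (\<lambda>H. submodule H K (V n)) hull
    (basis_vector K ` {p \<in> cliques M n. \<not> nesting_free M n p})"
  by (simp add: nes_relations_def clique_operad_simps)

lemma submodule_nes_relations: "submodule (nes_relations K M n) K (V n)"
  unfolding nes_relations_eq_hull
  by (rule module.submodule_hull[OF module_free_module]) (auto intro: basis_vector_closed)

text \<open>
  To map the relations, or the whole component, into the relations, a linear map need only do so
  on the generators.
\<close>

lemma linear_map_nes_relations_into:
  assumes F: "linear_map K (V n) (V N) F"
    and "\<And>p. \<lbrakk>p \<in> cliques M n; \<not> nesting_free M n p\<rbrakk>
      \<Longrightarrow> F (basis_vector K p) \<in> nes_relations K M N"
    and "y \<in> nes_relations K M n"
  shows "F y \<in> nes_relations K M N"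
proof -
  let ?H = "{y \<in> carrier (V n). F y \<in> nes_relations K M N}"
  have "submodule ?H K (V n)"
    by (rule submodule_vimage[OF module_free_module module_free_module F submodule_nes_relations])
  then have "nes_relations K M n \<subseteq> ?H"
    unfolding nes_relations_eq_hull[of n]
    by (intro hull_minimal) (use assms(2) basis_vector_closed in auto)
  with assms(3) show ?thesis by blast
qed

lemma linear_map_into_nes_relations:
  assumes F: "linear_map K (V n) (V N) F"
    and "\<And>p. p \<in> cliques M n \<Longrightarrow> F (basis_vector K p) \<in> nes_relations K M N"
    and "x \<in> carrier (V n)"
  shows "F x \<in> nes_relations K M N"
proof -
  let ?H = "{x \<in> carrier (V n). F x \<in> nes_relations K M N}"
  have "submodule ?H K (V n)"
    by (rule submodule_vimage[OF module_free_module module_free_module F submodule_nes_relations])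
  then have "?H = carrier (V n)"
    by (rule free_module_eq_span) (use assms(2) basis_vector_closed in auto)
  with assms(3) show ?thesis by blast
qed

lemma basis_vector_mem_nes_relations:
  "\<lbrakk>p \<in> cliques M n; \<not> nesting_free M n p\<rbrakk> \<Longrightarrow> basis_vector K p \<in> nes_relations K M n"
  unfolding nes_relations_eq_hull by (rule hull_inc) auto

lemma operad_ideal_nes_relations:
  assumes ud: "no_nontrivial_unit_divisors M"
  shows "operad_ideal K (clique_operad K M) (nes_relations K M)"
proof (intro operad_ideal.intro operad_ideal_axioms.intro ns_operad_clique_operad;
    (unfold clique_operad_simps)?)
  show "submodule (nes_relations K M n) K (V n)" for n by (rule submodule_nes_relations)
  have sub: "nes_relations K M n \<subseteq> carrier (V n)" for n
    by (rule module.submoduleE(1)[OF module_free_module submodule_nes_relations])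
  show "pc n m i x y \<in> nes_relations K M (n + m - 1)"
    if x: "x \<in> carrier (V n)" and y: "y \<in> nes_relations K M m" and i: "1 \<le> i" "i \<le> n" "1 \<le> m"
    for x y n m i
  proof (rule linear_map_into_nes_relations[OF linear_map_pc_left[OF _ i refl] _ x])
    show "y \<in> carrier (V m)" using sub y by blast
    fix p assume p: "p \<in> cliques M n"
    show "pc n m i (basis_vector K p) y \<in> nes_relations K M (n + m - 1)"
    proof (rule linear_map_nes_relations_into[OF linear_map_pc_right[OF _ i refl] _ y])
      show "basis_vector K p \<in> carrier (V n)" by (rule basis_vector_closed[OF p])
      fix q assume q: "q \<in> cliques M m" "\<not> nesting_free M m q"
      show "pc n m i (basis_vector K p) (basis_vector K q) \<in> nes_relations K M (n + m - 1)"
        unfolding bilinear_extension_basis_vector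
        by (intro basis_vector_mem_nes_relations clique_comp_closed
            not_nesting_free_clique_comp_right ud p q i)
    qed
  qed
  show "pc m n j y x \<in> nes_relations K M (m + n - 1)"
    if y: "y \<in> nes_relations K M m" and x: "x \<in> carrier (V n)" and j: "1 \<le> j" "j \<le> m" "1 \<le> n"
    for x y n m j
  proof (rule linear_map_into_nes_relations[OF linear_map_pc_right[OF _ j refl] _ x])
    show "y \<in> carrier (V m)" using sub y by blast
    fix q assume q: "q \<in> cliques M n"
    show "pc m n j y (basis_vector K q) \<in> nes_relations K M (m + n - 1)"
    proof (rule linear_map_nes_relations_into[OF linear_map_pc_left[OF _ j refl] _ y])
      show "basis_vector K q \<in> carrier (V n)" by (rule basis_vector_closed[OF q])
      fix p assume p: "p \<in> cliques M m" "\<not> nesting_free M m p"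
      show "pc m n j (basis_vector K p) (basis_vector K q) \<in> nes_relations K M (m + n - 1)"
        unfolding bilinear_extension_basis_vector
        by (intro basis_vector_mem_nes_relations clique_comp_closed
            not_nesting_free_clique_comp_left ud p q j)
    qed
  qed
qed

end

theorem proposition3p1p6:
  fixes K :: "'k ring" and M :: "'m monoid"
  assumes "field K"
    and "\<forall>n::nat. n > 0 \<longrightarrow> [n] \<cdot>\<^bsub>K\<^esub> \<one>\<^bsub>K\<^esub> \<noteq> \<zero>\<^bsub>K\<^esub>"
    and "unitary_magma M"
    and "no_nontrivial_unit_divisors M"
  shows "operad_ideal K (clique_operad K M) (nes_relations K M) \<and> ns_operad K (nes_operad K M)"
proof -
  interpret clique_operad_data K M
    using assms(1,3) by (rule clique_operad_data.intro)
  have ideal: "operad_ideal K (clique_operad K M) (nes_relations K M)"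
    by (rule operad_ideal_nes_relations[OF assms(4)])
  then have "ns_operad K (nes_operad K M)"
    unfolding nes_operad_def by (rule operad_ideal.ns_operad_quotient_operad)
  with ideal show ?thesis ..
qed

end
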